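(* Consider the system $$\dot x=y+X_{m+1}(x,y,\delta),\qquad \dot y=-g_m(x,\delta)-yf_{m-1}(x,\delta)+Y_{m+1}(x,y,\delta)$$ and the truncated polynomial system $$\dot x=y,\qquad \dot y=-g_m(x,\delta)-yf_{m-1}(x,\delta).$$ Let $P(x_0,\delta)-x_0=\sum_{j\ge1}v_j(\delta)x_0^j$ and $P_m(x_0,\delta)-x_0=\sum_{j\ge1}\bar v_j(\delta)x_0^j$ (for $x_0>0$ small) be the expansions of the Poincaré return maps $P$ and $P_m$ of the first and the second system, respectively. Then for any integer $k\ge1$, if $m\ge(k+2)n-2$, then $$v_j(\delta)=\bar v_j(\delta)\quad\text{for } 1\le j\le kn.$$
   Context: Here $n\ge2$ and $m>2n-1$ are integers, $\delta$ ranges over a compact parameter set $D$ in a Euclidean space, $$g_m(x,\delta)=\sum_{j=2n-1}^m a_j(\delta)x^j,\qquad f_{m-1}(x,\delta)=\sum_{j=n-1}^{m-1}b_j(\delta)x^j,$$ with $a_{2n-1}(\delta)>0$ and $b_{n-1}^2(\delta)-4na_{2n-1}(\delta)<0$, and $X_{m+1},Y_{m+1}$ are analytic functions with $X_{m+1},Y_{m+1}=O(|x,y|^{m+1})$ near the origin. For both systems the origin is a center or a focus. Poincaré return map of a system $\dot x=y+X(x,y,\delta),\ \dot y=Y(x,y,\delta)$ of this kind: let $y=F(x,\delta)$ be the solution of $y+X(x,y,\delta)=0$ with $F(0,\delta)=0$ (so $F\equiv0$ when $X\equiv 0$). For $x_0\ne0$ with $|x_0|$ small, let $(x(t,x_0,\delta),y(t,x_0,\delta))$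 be the solution with initial condition $(x_0,F(x_0,\delta))$, and let $\tau>0$ be the least positive number such that $y(\tau,x_0,\delta)=F(x(\tau,x_0,\delta),\delta)$ and $x_0\,x(\tau,x_0,\delta)>0$; the return map sends $x_0$ to $x(\tau,x_0,\delta)$. For $x_0>0$ small it coincides with a function analytic at $x_0=0$. *)

theory Defs
  imports "HOL-Analysis.Analysis" "HOL-Library.Landau_Symbols"
begin

definition real_analytic2_at_origin :: "(real \<Rightarrow> real \<Rightarrow> real) \<Rightarrow> bool" where
  "real_analytic2_at_origin f \<longleftrightarrow>
     (\<exists>(c :: nat \<Rightarrow> nat \<Rightarrow> real) r. r > 0 \<and>
        (\<forall>x y. \<bar>x\<bar> < r \<longrightarrow> \<bar>y\<bar> < r \<longrightarrow>
           ((\<lambda>(i, j). c i j * x ^ i * y ^ j) has_sum f x y) UNIV))"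

definition lienard_g :: "nat \<Rightarrow> nat \<Rightarrow> (nat \<Rightarrow> 'd \<Rightarrow> real) \<Rightarrow> real \<Rightarrow> 'd \<Rightarrow> real" where
  "lienard_g n m a x \<delta> = (\<Sum>j = 2 * n - 1..m. a j \<delta> * x ^ j)"

definition lienard_f :: "nat \<Rightarrow> nat \<Rightarrow> (nat \<Rightarrow> 'd \<Rightarrow> real) \<Rightarrow> real \<Rightarrow> 'd \<Rightarrow> real" where
  "lienard_f n m b x \<delta> = (\<Sum>j = n - 1..m - 1. b j \<delta> * x ^ j)"

text \<open>The definitions below concern the planar system
  \<open>x' = y + X(x, y)\<close>, \<open>y' = Y(x, y)\<close> for a fixed parameter value.
  Functions are total, but only their behaviour near the origin matters.\<close>

definition solves_on ::
  "(real \<Rightarrow> real \<Rightarrow> real) \<Rightarrow> (real \<Rightarrow> real \<Rightarrow> real) \<Rightarrow> (real \<Rightarrow> real) \<Rightarrow> (real \<Rightarrow> real) \<Rightarrow> real \<Rightarrow> bool" where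
  "solves_on X Y x y \<tau> \<longleftrightarrow>
     (\<forall>t\<in>{0..\<tau>}.
        (x has_real_derivative y t + X (x t) (y t)) (at t within {0..\<tau>}) \<and>
        (y has_real_derivative Y (x t) (y t)) (at t within {0..\<tau>}))"

text \<open>The local solution \<open>y = F(x)\<close> of \<open>y + X(x, y) = 0\<close> through the origin. Continuity at
  \<open>0\<close> singles out the branch given by the implicit function theorem, so for \<open>X\<close> analytic
  with vanishing linear part the germ of \<open>F\<close> at \<open>0\<close> is unique.\<close>

definition section_curve :: "(real \<Rightarrow> real \<Rightarrow> real) \<Rightarrow> (real \<Rightarrow> real) \<Rightarrow> bool" where
  "section_curve X F \<longleftrightarrow>
     F 0 = 0 \<and> isCont F 0 \<and> (\<forall>\<^sub>F x in nhds 0. F x + X x (F x) = 0)"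

definition first_return ::
  "(real \<Rightarrow> real \<Rightarrow> real) \<Rightarrow> (real \<Rightarrow> real \<Rightarrow> real) \<Rightarrow> (real \<Rightarrow> real) \<Rightarrow> real \<Rightarrow> real \<Rightarrow> bool" where
  "first_return X Y F x0 p \<longleftrightarrow>
     (\<exists>x y \<tau>. \<tau> > 0 \<and> solves_on X Y x y \<tau> \<and> x 0 = x0 \<and> y 0 = F x0 \<and>
        y \<tau> = F (x \<tau>) \<and> x0 * x \<tau> > 0 \<and>
        (\<forall>t. 0 < t \<and> t < \<tau> \<longrightarrow> \<not> (y t = F (x t) \<and> x0 * x t > 0)) \<and>
        p = x \<tau>)"

definition poincare_return_map ::
  "(real \<Rightarrow> real \<Rightarrow> real) \<Rightarrow> (real \<Rightarrow> real \<Rightarrow> real) \<Rightarrow> (real \<Rightarrow> real) \<Rightarrow> bool" where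
  "poincare_return_map X Y P \<longleftrightarrow>
     (\<exists>F. section_curve X F \<and> (\<forall>\<^sub>F x0 in at 0. first_return X Y F x0 (P x0)))"

definition return_expansion :: "(real \<Rightarrow> real) \<Rightarrow> (nat \<Rightarrow> real) \<Rightarrow> bool" where
  "return_expansion P v \<longleftrightarrow>
     (\<forall>\<^sub>F x0 in at_right 0. (\<lambda>j. v (Suc j) * x0 ^ Suc j) sums (P x0 - x0))"

end

theory Submission
  imports Defs
begin

text \<open>
  Fix the parameter. The lowest-order part of the system is quasi-homogeneous: put \<open>h = x\<^sub>0\<close>,
  \<open>x = h u\<close>, \<open>y = h\<^sup>n w\<close> and measure time in units of \<open>h\<^sup>1\<^sup>-\<^sup>n\<close>. The polynomial system becomes
  \<open>u' = w\<close>, \<open>w' = - Q h u w\<close>, where \<open>Q\<close> is a polynomial in all three variables and \<open>Q 0\<close> gives the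
  model system \<open>w' = - \<alpha> u\<^sup>2\<^sup>n\<^sup>-\<^sup>1 - \<beta> u\<^sup>n\<^sup>-\<^sup>1 w\<close> with \<open>\<alpha> = a\<^sub>2\<^sub>n\<^sub>-\<^sub>1\<close>, \<open>\<beta> = b\<^sub>n\<^sub>-\<^sub>1\<close>. The starting point becomes
  \<open>(1, 0)\<close>, up to a small error. Terms of order \<open>m + 1\<close> in \<open>(x, y)\<close> contribute \<open>O(h\<^sup>m\<^sup>+\<^sup>1\<^sup>-\<^sup>n)\<close> to \<open>u'\<close> and
  \<open>O(h\<^sup>m\<^sup>+\<^sup>2\<^sup>-\<^sup>2\<^sup>n)\<close> to \<open>w'\<close>; the hypothesis \<open>m \<ge> (k + 2) n - 2\<close> says exactly that the exponent
  \<open>m + 2 - 2n\<close> is at least \<open>kn\<close>. So, after rescaling, the two systems differ by \<open>O(h\<^sup>k\<^sup>n)\<close>. If their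
  first return points then also differ by \<open>O(h\<^sup>k\<^sup>n)\<close>, scaling back gives a difference
  \<open>O(h\<^sup>k\<^sup>n\<^sup>+\<^sup>1)\<close> of the return maps, and the coefficients of two power series that agree to this order
  coincide up to index \<open>kn\<close> (\<open>power_series_coeffs_zero\<close>).

  The return points are compared as follows. Because \<open>\<beta>\<^sup>2 < 4n\<alpha>\<close>, the model orbit through \<open>(1, 0)\<close>
  turns once around the origin and meets the positive \<open>u\<close>-axis again, transversally
  (\<open>model_system_returns\<close>). A Gronwall estimate keeps every rescaled orbit, as long as it has not
  returned, close to the model orbit, so by transversality its first return happens near the model
  return time \<open>T0\<close> (\<open>return_time_near\<close>). A second Gronwall estimate, now between the two
  rescaled orbits, together with the nonzero speed at which they cross the section, bounds the distance
  of the return points (\<open>returns_close\<close>).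

  Two points need care. The section \<open>y = F x\<close> is the curve where \<open>x' = 0\<close>; it moves with the
  perturbation, and one must exclude that an orbit meets it again immediately after leaving it. Both
  are controlled by the fact that an analytic function of order \<open>m + 1\<close> has a Lipschitz constant of
  order \<open>\<rho>\<^sup>m\<close> on the square of radius \<open>\<rho>\<close> (\<open>analytic_flat_Lipschitz\<close>).
\<close>

section \<open>Power series of high order\<close>

text \<open>
  Divide by the power of \<open>t\<close> belonging to the first coefficient in question: the quotient series tends
  to this coefficient at \<open>0\<close>, and the growth bound makes the quotient tend to \<open>0\<close>.
\<close>

lemma power_series_coeffs_zero:
  fixes c :: "nat \<Rightarrow> real"
  assumes sums: "\<forall>\<^sub>F t in at_right 0. (\<lambda>j. c j * t ^ j) sums f t"
    and bound: "f \<in> O[at_right 0](\<lambda>t. t ^ N)" and "j < N"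
  shows "c j = 0"
  using \<open>j < N\<close>
proof (induction j rule: less_induct)
  case (less j)
  from sums obtain r where r: "r > 0" "\<And>t. 0 < t \<Longrightarrow> t < r \<Longrightarrow> (\<lambda>j. c j * t ^ j) sums f t"
    by (auto simp: eventually_at_right_field)
  obtain C where "C > 0" and C: "\<forall>\<^sub>F t in at_right 0. norm (f t) \<le> C * norm (t ^ N)"
    using bound by (rule landau_o.bigE)
  define g where "g t = (\<Sum>i. c (i + j) * t ^ i)" for t :: real
  have "(\<lambda>i. c (i + j) * t ^ i) sums g t" if "norm t < r / 2" for t
  proof -
    have "summable (\<lambda>i. c i * (r / 2) ^ i)"
      using r(2)[of "r / 2"] \<open>r > 0\<close> by (auto simp: sums_iff)
    then have "summable (\<lambda>i. c i * t ^ i)"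
      by (rule powser_inside) (use that \<open>r > 0\<close> in auto)
    then have "summable (\<lambda>i. c (i + j) * t ^ i)"
      by (simp add: summable_powser_ignore_initial_segment)
    then show ?thesis unfolding g_def by (rule summable_sums)
  qed
  then have "(g \<longlongrightarrow> c (0 + j)) (at 0)"
    using \<open>r > 0\<close> by (intro powser_limit_0[of "r / 2"]) auto
  then have lim: "(g \<longlongrightarrow> c j) (at_right 0)"
    by (simp add: filterlim_at_split)
  have f_eq: "f t = t ^ j * g t" if "0 < t" "t < r" for t
  proof -
    have s: "(\<lambda>i. c i * t ^ i) sums f t" using r(2) that by simp
    have "f t = (\<Sum>i. c (i + j) * t ^ (i + j)) + (\<Sum>i<j. c i * t ^ i)"
      using suminf_split_initial_segment[of "\<lambda>i. c i * t ^ i" j] s by (simp add: sums_iff)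
    also have "(\<Sum>i<j. c i * t ^ i) = 0"
      using less by (intro sum.neutral) auto
    also have "(\<Sum>i. c (i + j) * t ^ (i + j)) = (\<Sum>i. t ^ j * (c (i + j) * t ^ i))"
      by (simp add: power_add mult_ac)
    also have "\<dots> = t ^ j * g t"
      unfolding g_def using s
      by (intro suminf_mult) (simp add: summable_powser_ignore_initial_segment sums_iff)
    finally show ?thesis by simp
  qed
  have "\<forall>\<^sub>F t in at_right 0. 0 < t \<and> t < min r 1"
    using \<open>r > 0\<close> by (intro eventually_conj eventually_at_right_less eventually_at_rightI[of 0 "min r 1"]) auto
  then have "\<forall>\<^sub>F t in at_right 0. norm (g t) \<le> C * t"
    using C
  proof eventually_elim
    case (elim t)
    have "t ^ j * norm (g t) \<le> C * t ^ N"
      using elim f_eq[of t] by (simp add: abs_mult)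
    also have "t ^ N \<le> t ^ (Suc j)"
      using elim less.prems by (intro power_decreasing) auto
    finally have "t ^ j * norm (g t) \<le> t ^ j * (C * t)"
      using \<open>C > 0\<close> by (simp add: mult_ac)
    then show ?case using elim by simp
  qed
  moreover have "((\<lambda>t. C * t) \<longlongrightarrow> 0) (at_right 0)"
    by (auto intro!: tendsto_eq_intros)
  ultimately have "(g \<longlongrightarrow> 0) (at_right 0)"
    by (rule Lim_null_comparison)
  with lim show ?case
    using tendsto_unique trivial_limit_at_right_real by blast
qed

lemma return_expansion_diff_sums:
  assumes "return_expansion P v" "return_expansion P' v'"
  shows "\<forall>\<^sub>F t in at_right 0. (\<lambda>j. (if j = 0 then 0 else v j - v' j) * t ^ j) sums (P t - P' t)"
proof -
  have "\<forall>\<^sub>F t in at_right 0. (\<lambda>j. v (Suc j) * t ^ Suc j) sums (P t - t) \<and>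
      (\<lambda>j. v' (Suc j) * t ^ Suc j) sums (P' t - t)"
    using assms by (simp add: return_expansion_def eventually_conj_iff)
  then show ?thesis
  proof eventually_elim
    case (elim t)
    then have "(\<lambda>j. v (Suc j) * t ^ Suc j - v' (Suc j) * t ^ Suc j) sums ((P t - t) - (P' t - t))"
      by (intro sums_diff) auto
    then have "(\<lambda>j. (if Suc j = 0 then 0 else v (Suc j) - v' (Suc j)) * t ^ Suc j) sums (P t - P' t)"
      by (simp add: left_diff_distrib)
    then show ?case
      by (subst (asm) sums_Suc_iff) simp
  qed
qed

text \<open>
  For a \<open>C\<^sup>1\<close> function vanishing at the origin this is the statement that its gradient is
  \<open>O(\<rho>\<^sup>N)\<close> on the square of radius \<open>\<rho>\<close>. In this form derivatives of double series are avoided, and the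
  bound by \<open>O(\<rho>\<^sup>N\<^sup>+\<^sup>1)\<close> for the function itself is the case where the second point is the origin.
\<close>

definition flat_Lipschitz :: "nat \<Rightarrow> real \<Rightarrow> real \<Rightarrow> (real \<Rightarrow> real \<Rightarrow> real) \<Rightarrow> bool" where
  "flat_Lipschitz N K r f \<longleftrightarrow> f 0 0 = 0 \<and> (\<forall>\<rho> x1 x2 y1 y2. \<rho> \<le> r \<longrightarrow>
     \<bar>x1\<bar> \<le> \<rho> \<longrightarrow> \<bar>x2\<bar> \<le> \<rho> \<longrightarrow> \<bar>y1\<bar> \<le> \<rho> \<longrightarrow> \<bar>y2\<bar> \<le> \<rho> \<longrightarrow>
     \<bar>f x1 y1 - f x2 y2\<bar> \<le> K * \<rho> ^ N * (\<bar>x1 - x2\<bar> + \<bar>y1 - y2\<bar>))"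

lemma flat_LipschitzD:
  assumes "flat_Lipschitz N K r f" "\<rho> \<le> r" "\<bar>x1\<bar> \<le> \<rho>" "\<bar>x2\<bar> \<le> \<rho>" "\<bar>y1\<bar> \<le> \<rho>" "\<bar>y2\<bar> \<le> \<rho>"
  shows "\<bar>f x1 y1 - f x2 y2\<bar> \<le> K * \<rho> ^ N * (\<bar>x1 - x2\<bar> + \<bar>y1 - y2\<bar>)"
  using assms unfolding flat_Lipschitz_def by blast

lemma flat_Lipschitz_zero: "K \<ge> 0 \<Longrightarrow> flat_Lipschitz N K r (\<lambda>x y. 0)"
  unfolding flat_Lipschitz_def by (force intro!: mult_nonneg_nonneg)

lemma flat_Lipschitz_mono:
  assumes "flat_Lipschitz N K r f" "K \<le> K'" "r' \<le> r"
  shows "flat_Lipschitz N K' r' f"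
  unfolding flat_Lipschitz_def
proof (intro conjI allI impI)
  show "f 0 0 = 0" using assms(1) by (simp add: flat_Lipschitz_def)
  fix \<rho> x1 x2 y1 y2
  assume *: "\<rho> \<le> r'" "\<bar>x1\<bar> \<le> \<rho>" "\<bar>x2\<bar> \<le> \<rho>" "\<bar>y1\<bar> \<le> \<rho>" "\<bar>y2\<bar> \<le> \<rho>"
  have "\<bar>f x1 y1 - f x2 y2\<bar> \<le> K * \<rho> ^ N * (\<bar>x1 - x2\<bar> + \<bar>y1 - y2\<bar>)"
    using * assms by (intro flat_LipschitzD[OF assms(1)]) auto
  also have "\<dots> \<le> K' * \<rho> ^ N * (\<bar>x1 - x2\<bar> + \<bar>y1 - y2\<bar>)"
    using * assms by (intro mult_right_mono) auto
  finally show "\<bar>f x1 y1 - f x2 y2\<bar> \<le> K' * \<rho> ^ N * (\<bar>x1 - x2\<bar> + \<bar>y1 - y2\<bar>)" .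
qed

text \<open>
  On a ray \<open>t \<mapsto> (t x, t y)\<close>, collecting the terms of total degree \<open>l\<close> gives a power series in \<open>t\<close> whose
  coefficients are the homogeneous parts \<open>d l x y\<close>. These vanish for \<open>l < N\<close>, and a polynomial in \<open>x\<close>
  that vanishes on an interval has zero coefficients.
\<close>

lemma double_power_series_coeffs_zero:
  fixes c :: "nat \<Rightarrow> nat \<Rightarrow> real"
  assumes "r > 0"
    and sum: "\<And>x y. \<bar>x\<bar> < r \<Longrightarrow> \<bar>y\<bar> < r \<Longrightarrow>
        ((\<lambda>(i, j). c i j * x ^ i * y ^ j) has_sum f x y) UNIV"
    and bound: "(\<lambda>z. f (fst z) (snd z)) \<in> O[nhds (0, 0)](\<lambda>z. norm z ^ N)"
    and "i + j < N"
  shows "c i j = 0"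
proof -
  define d where "d l x y = (\<Sum>i\<le>l. c i (l - i) * x ^ i * y ^ (l - i))" for l and x y :: real
  have d_zero: "d l x y = 0" if "l < N" "\<bar>x\<bar> < r" "\<bar>y\<bar> < r" for l x y
  proof (rule power_series_coeffs_zero[OF _ _ \<open>l < N\<close>])
    have "(\<lambda>l. d l x y * t ^ l) sums f (t * x) (t * y)" if t: "0 < t" "t < 1" for t
    proof -
      have small: "\<bar>t * z\<bar> < r" if "\<bar>z\<bar> < r" for z
      proof -
        have "\<bar>t * z\<bar> \<le> 1 * \<bar>z\<bar>" unfolding abs_mult using t by (intro mult_right_mono) auto
        then show ?thesis using that by simp
      qed
      have "((\<lambda>(i, j). c i j * (t * x) ^ i * (t * y) ^ j) has_sum f (t * x) (t * y)) UNIV"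
        using sum small \<open>\<bar>x\<bar> < r\<close> \<open>\<bar>y\<bar> < r\<close> by simp
      also have "?this \<longleftrightarrow> ((\<lambda>(l, i). c i (l - i) * (t * x) ^ i * (t * y) ^ (l - i))
          has_sum f (t * x) (t * y)) (SIGMA l:UNIV. {..l})"
        by (rule has_sum_reindex_bij_witness[where i = "\<lambda>(l, i). (i, l - i)" and j = "\<lambda>(i, j). (i + j, i)"])
           auto
      finally have "((\<lambda>l. d l x y * t ^ l) has_sum f (t * x) (t * y)) UNIV"
      proof (rule has_sum_SigmaD, simp only: split)
        fix l
        have "d l x y * t ^ l = (\<Sum>i\<le>l. c i (l - i) * (t * x) ^ i * (t * y) ^ (l - i))"
          unfolding d_def sum_distrib_right
        proof (rule sum.cong)
          fix i assume "i \<in> {..l}"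
          then have "t ^ l = t ^ i * t ^ (l - i)" by (simp add: power_add[symmetric])
          then show "c i (l - i) * x ^ i * y ^ (l - i) * t ^ l = c i (l - i) * (t * x) ^ i * (t * y) ^ (l - i)"
            by (simp add: power_mult_distrib mult_ac)
        qed simp
        then show "((\<lambda>i. c i (l - i) * (t * x) ^ i * (t * y) ^ (l - i)) has_sum d l x y * t ^ l) {..l}"
          by simp
      qed
      then show ?thesis by (rule has_sum_imp_sums)
    qed
    then show "\<forall>\<^sub>F t in at_right 0. (\<lambda>l. d l x y * t ^ l) sums f (t * x) (t * y)"
      by (intro eventually_at_rightI[of 0 1]) auto
    have "filterlim (\<lambda>t. (t * x, t * y)) (nhds (0, 0)) (at_right 0)"
      by (auto intro!: tendsto_eq_intros simp flip: nhds_prod)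
    from landau_o.big.compose[OF bound this]
    have "(\<lambda>t. f (t * x) (t * y)) \<in> O[at_right 0](\<lambda>t. norm (t * x, t * y) ^ N)" by simp
    also have "(\<lambda>t. norm (t * x, t * y) ^ N) = (\<lambda>t. norm (x, y) ^ N * \<bar>t\<bar> ^ N)"
    proof
      fix t :: real
      have "norm (t * x, t * y) = \<bar>t\<bar> * norm (x, y)"
        using norm_scaleR[of t "(x, y)"] by simp
      then show "norm (t * x, t * y) ^ N = norm (x, y) ^ N * \<bar>t\<bar> ^ N"
        by (simp add: power_mult_distrib)
    qed
    also have "\<dots> \<in> O[at_right 0](\<lambda>t. t ^ N)"
    proof (rule landau_o.bigI)
      show "norm (x, y) ^ N + 1 > 0" by (intro add_nonneg_pos) auto
      have "norm (norm (x, y) ^ N * \<bar>t\<bar> ^ N) \<le> (norm (x, y) ^ N + 1) * norm (t ^ N)" for t :: real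
        by (simp add: abs_mult power_abs algebra_simps)
      then show "\<forall>\<^sub>F t in at_right 0. norm (norm (x, y) ^ N * \<bar>t\<bar> ^ N) \<le> (norm (x, y) ^ N + 1) * norm (t ^ N)"
        by simp
    qed
    finally show "(\<lambda>t. f (t * x) (t * y)) \<in> O[at_right 0](\<lambda>t. t ^ N)" .
  qed
  \<comment> \<open>Freeze \<open>y = r / 2 \<noteq> 0\<close>, so that the homogeneous part becomes a polynomial in \<open>x\<close>.\<close>
  have "infinite {x. (\<Sum>k\<le>i + j. (c k (i + j - k) * (r / 2) ^ (i + j - k)) * x ^ k) = 0}"
  proof (rule infinite_super)
    show "{0<..<r} \<subseteq> {x. (\<Sum>k\<le>i + j. (c k (i + j - k) * (r / 2) ^ (i + j - k)) * x ^ k) = 0}"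
      using d_zero[OF \<open>i + j < N\<close>, of _ "r / 2"] \<open>r > 0\<close> by (auto simp: d_def mult_ac)
    show "infinite {0<..<r}" using \<open>r > 0\<close> by simp
  qed
  then have "c i (i + j - i) * (r / 2) ^ (i + j - i) = 0"
    unfolding polyfun_finite_roots by (metis le_add1)
  then show ?thesis using \<open>r > 0\<close> by simp
qed

lemma power_diff_bound:
  fixes x y :: real
  assumes "\<bar>x\<bar> \<le> \<rho>" "\<bar>y\<bar> \<le> \<rho>"
  shows "\<bar>x ^ i - y ^ i\<bar> \<le> real i * \<rho> ^ (i - 1) * \<bar>x - y\<bar>"
proof (cases i)
  case (Suc k)
  have "\<bar>\<Sum>p<Suc k. x ^ p * y ^ (k - p)\<bar> \<le> (\<Sum>p<Suc k. \<rho> ^ k)"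
  proof (intro order_trans[OF sum_abs] sum_mono)
    fix p assume p: "p \<in> {..<Suc k}"
    have "\<bar>x ^ p * y ^ (k - p)\<bar> \<le> \<rho> ^ p * \<rho> ^ (k - p)"
      unfolding abs_mult power_abs using assms by (intro mult_mono power_mono) auto
    also have "\<dots> = \<rho> ^ k" using p by (simp flip: power_add)
    finally show "\<bar>x ^ p * y ^ (k - p)\<bar> \<le> \<rho> ^ k" .
  qed
  then have "\<bar>x - y\<bar> * \<bar>\<Sum>p<Suc k. x ^ p * y ^ (k - p)\<bar> \<le> \<bar>x - y\<bar> * (\<Sum>p<Suc k. \<rho> ^ k)"
    by (rule mult_left_mono) simp
  then show ?thesis unfolding Suc diff_power_eq_sum abs_mult by (simp add: mult_ac)
qed simp

lemma monomial_diff_bound: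
  fixes x1 x2 y1 y2 :: real
  assumes "\<bar>x1\<bar> \<le> \<rho>" "\<bar>x2\<bar> \<le> \<rho>" "\<bar>y1\<bar> \<le> \<rho>" "\<bar>y2\<bar> \<le> \<rho>"
  shows "\<bar>x1 ^ i * y1 ^ j - x2 ^ i * y2 ^ j\<bar>
    \<le> real (i + j) * \<rho> ^ (i + j - 1) * (\<bar>x1 - x2\<bar> + \<bar>y1 - y2\<bar>)"
proof -
  have "\<rho> \<ge> 0" using assms by linarith
  have "\<bar>x1 ^ i * y1 ^ j - x2 ^ i * y2 ^ j\<bar> = \<bar>(x1 ^ i - x2 ^ i) * y1 ^ j + x2 ^ i * (y1 ^ j - y2 ^ j)\<bar>"
    by (simp add: algebra_simps)
  also have "\<dots> \<le> \<bar>x1 ^ i - x2 ^ i\<bar> * \<bar>y1\<bar> ^ j + \<bar>x2\<bar> ^ i * \<bar>y1 ^ j - y2 ^ j\<bar>"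
    by (intro order_trans[OF abs_triangle_ineq]) (simp add: abs_mult power_abs)
  also have "\<dots> \<le> (real i * \<rho> ^ (i - 1) * \<bar>x1 - x2\<bar>) * \<rho> ^ j + \<rho> ^ i * (real j * \<rho> ^ (j - 1) * \<bar>y1 - y2\<bar>)"
    using assms \<open>\<rho> \<ge> 0\<close> by (intro add_mono mult_mono power_diff_bound power_mono) auto
  also have "\<dots> = \<rho> ^ (i + j - 1) * (real i * \<bar>x1 - x2\<bar> + real j * \<bar>y1 - y2\<bar>)"
    by (cases i; cases j) (simp_all add: power_add algebra_simps)
  also have "\<dots> \<le> \<rho> ^ (i + j - 1) * (real (i + j) * \<bar>x1 - x2\<bar> + real (i + j) * \<bar>y1 - y2\<bar>)"
    using \<open>\<rho> \<ge> 0\<close> by (intro mult_left_mono add_mono mult_right_mono) auto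
  finally show ?thesis by (simp add: algebra_simps)
qed

text \<open>
  Only monomials of degree \<open>l + 1 > N\<close> occur. Each varies by at most \<open>(l + 1) \<rho>\<^sup>l\<close> times the
  displacement, and \<open>l + 1 \<le> 2\<^sup>l\<close> turns this into \<open>(2\<rho>/s)\<^sup>l s\<^sup>l\<close>. For \<open>2\<rho> \<le> s\<close> the first factor
  is at most \<open>(2\<rho>/s)\<^sup>N\<close>, and the second is summed up by the absolutely convergent series at \<open>(s, s)\<close>.
\<close>

lemma analytic_flat_Lipschitz:
  assumes "real_analytic2_at_origin f"
    and "(\<lambda>z. f (fst z) (snd z)) \<in> O[nhds (0, 0)](\<lambda>z. norm z ^ Suc N)"
  obtains K r where "K \<ge> 0" "r > 0" "flat_Lipschitz N K r f"
proof -
  from assms(1) obtain c r where "r > 0"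
    and sum: "\<And>x y. \<bar>x\<bar> < r \<Longrightarrow> \<bar>y\<bar> < r \<Longrightarrow> ((\<lambda>(i, j). c i j * x ^ i * y ^ j) has_sum f x y) UNIV"
    unfolding real_analytic2_at_origin_def by blast
  note zero = double_power_series_coeffs_zero[OF \<open>r > 0\<close> sum assms(2)]
  define s where "s = r / 2"
  have "s > 0" "s < r" using \<open>r > 0\<close> by (auto simp: s_def)
  define S where "S = (\<Sum>\<^sub>\<infinity>(i, j). \<bar>c i j\<bar> * s ^ (i + j))"
  have S_sum: "((\<lambda>(i, j). \<bar>c i j\<bar> * s ^ (i + j)) has_sum S) UNIV"
  proof -
    have "(\<lambda>(i, j). c i j * s ^ i * s ^ j) summable_on UNIV"
      using sum[of s s] \<open>s > 0\<close> \<open>s < r\<close> by (auto simp: summable_on_def)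
    then have "(\<lambda>p. norm ((\<lambda>(i, j). c i j * s ^ i * s ^ j) p)) summable_on UNIV"
      by (rule summable_on_iff_abs_summable_on_real[THEN iffD1])
    also have "(\<lambda>p. norm ((\<lambda>(i, j). c i j * s ^ i * s ^ j) p)) = (\<lambda>(i, j). \<bar>c i j\<bar> * s ^ (i + j))"
      using \<open>s > 0\<close> by (auto simp: fun_eq_iff abs_mult power_add)
    finally show ?thesis unfolding S_def by (rule has_sum_infsum)
  qed
  have "S \<ge> 0"
    using has_sum_nonneg[OF S_sum] \<open>s > 0\<close> by auto
  define K where "K = (2 / s) ^ N / s * S"
  show thesis
  proof (rule that)
    show "K \<ge> 0" using \<open>S \<ge> 0\<close> \<open>s > 0\<close> by (simp add: K_def)
    show "s / 2 > 0" using \<open>s > 0\<close> by simp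
    show "flat_Lipschitz N K (s / 2) f"
      unfolding flat_Lipschitz_def
    proof (intro conjI allI impI)
      have "((\<lambda>(i, j). 0) has_sum f 0 0) (UNIV :: (nat \<times> nat) set)"
      proof (rule has_sum_cong[THEN iffD1, OF _ sum[of 0 0]])
        fix p :: "nat \<times> nat"
        show "(case p of (i, j) \<Rightarrow> c i j * 0 ^ i * 0 ^ j) = (case p of (i, j) \<Rightarrow> 0)"
          using zero[of 0 0] by (cases p; cases "fst p"; cases "snd p") auto
      qed (use \<open>r > 0\<close> in auto)
      then show "f 0 0 = 0"
        by (metis (mono_tags, lifting) has_sum_0 has_sum_unique split_beta')
      fix \<rho> x1 x2 y1 y2 :: real
      assume \<rho>: "\<rho> \<le> s / 2" and le: "\<bar>x1\<bar> \<le> \<rho>" "\<bar>x2\<bar> \<le> \<rho>" "\<bar>y1\<bar> \<le> \<rho>" "\<bar>y2\<bar> \<le> \<rho>"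
      have "\<rho> \<ge> 0" using le by linarith
      define d where "d = \<bar>x1 - x2\<bar> + \<bar>y1 - y2\<bar>"
      have "d \<ge> 0" by (simp add: d_def)
      have "((\<lambda>(i, j). c i j * (x1 ^ i * y1 ^ j - x2 ^ i * y2 ^ j)) has_sum f x1 y1 - f x2 y2) UNIV"
      proof -
        have "\<rho> < r" using \<rho> \<open>s < r\<close> \<open>s > 0\<close> by linarith
        then have "((\<lambda>p. (\<lambda>(i, j). c i j * x1 ^ i * y1 ^ j) p + - (\<lambda>(i, j). c i j * x2 ^ i * y2 ^ j) p)
            has_sum f x1 y1 + - f x2 y2) UNIV"
          using le by (intro has_sum_add has_sum_uminusI sum) auto
        then show ?thesis by (simp add: split_beta' algebra_simps)
      qed
      moreover have "((\<lambda>p. (2 * \<rho> / s) ^ N / s * d * (\<lambda>(i, j). \<bar>c i j\<bar> * s ^ (i + j)) p)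
          has_sum (2 * \<rho> / s) ^ N / s * d * S) UNIV"
        by (intro has_sum_cmult_right S_sum)
      ultimately have "norm (f x1 y1 - f x2 y2) \<le> (2 * \<rho> / s) ^ N / s * d * S"
      proof (rule norm_infsum_le)
        fix p :: "nat \<times> nat"
        obtain i j where p: "p = (i, j)" by (cases p)
        have "\<bar>c i j\<bar> * \<bar>x1 ^ i * y1 ^ j - x2 ^ i * y2 ^ j\<bar> \<le> \<bar>c i j\<bar> * ((2 * \<rho> / s) ^ N / s * d * s ^ (i + j))"
        proof (cases "i + j < Suc N")
          case True
          then show ?thesis using zero by simp
        next
          case False
          then obtain l where l: "i + j = Suc l" "N \<le> l" by (cases "i + j") auto
          have "real (Suc l) \<le> 2 ^ l" by (induction l) auto
          have "\<bar>x1 ^ i * y1 ^ j - x2 ^ i * y2 ^ j\<bar> \<le> real (Suc l) * \<rho> ^ l * d"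
            using monomial_diff_bound[OF le, of i j] l by (simp add: d_def)
          also have "\<dots> \<le> 2 ^ l * \<rho> ^ l * d"
            using \<open>real (Suc l) \<le> 2 ^ l\<close> \<open>d \<ge> 0\<close> \<open>\<rho> \<ge> 0\<close> by (intro mult_right_mono) auto
          also have "2 ^ l * \<rho> ^ l * d = (2 * \<rho> / s) ^ l * (s ^ l * d)"
            using \<open>s > 0\<close> by (simp add: power_mult_distrib power_divide)
          also have "\<dots> \<le> (2 * \<rho> / s) ^ N * (s ^ l * d)"
            using \<open>s > 0\<close> \<open>d \<ge> 0\<close> \<open>\<rho> \<ge> 0\<close> \<rho> l by (intro mult_right_mono power_decreasing) auto
          also have "\<dots> = (2 * \<rho> / s) ^ N / s * d * s ^ (i + j)"
            using \<open>s > 0\<close> l by simp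
          finally show ?thesis by (rule mult_left_mono) simp
        qed
        then show "norm (case p of (i, j) \<Rightarrow> c i j * (x1 ^ i * y1 ^ j - x2 ^ i * y2 ^ j))
            \<le> (2 * \<rho> / s) ^ N / s * d * (case p of (i, j) \<Rightarrow> \<bar>c i j\<bar> * s ^ (i + j))"
          by (simp add: p abs_mult mult_ac)
      qed
      also have "(2 * \<rho> / s) ^ N / s * d * S = K * \<rho> ^ N * d"
        by (simp add: K_def power_mult_distrib power_divide)
      finally show "\<bar>f x1 y1 - f x2 y2\<bar> \<le> K * \<rho> ^ N * (\<bar>x1 - x2\<bar> + \<bar>y1 - y2\<bar>)"
        by (simp add: d_def)
    qed
  qed
qed

section \<open>The quasi-homogeneous model system\<close>

text \<open>
  This form, with \<open>p = cos\<^sup>n \<theta>\<close> and \<open>q = sin \<theta>\<close>, is the numerator of the angular speed of the model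
  system; completing the square shows that a focus turns in one direction only.
\<close>

lemma quadratic_form_pos:
  fixes \<alpha> \<beta> n p q :: real
  assumes "\<alpha> > 0" and "\<beta>\<^sup>2 < 4 * n * \<alpha>" and "p \<noteq> 0 \<or> q \<noteq> 0"
  shows "\<alpha> * p\<^sup>2 - \<beta> * p * q + n * q\<^sup>2 > 0"
proof -
  have "0 < (2 * \<alpha> * p - \<beta> * q)\<^sup>2 + (4 * n * \<alpha> - \<beta>\<^sup>2) * q\<^sup>2"
  proof (cases "q = 0")
    case True
    then show ?thesis using assms by simp
  next
    case False
    then show ?thesis using assms
      by (intro add_nonneg_pos mult_pos_pos) auto
  qed
  also have "\<dots> = 4 * \<alpha> * (\<alpha> * p\<^sup>2 - \<beta> * p * q + n * q\<^sup>2)"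
    by (simp add: power2_eq_square algebra_simps)
  finally show ?thesis
    using assms(1) by (simp add: zero_less_mult_iff)
qed

text \<open>
  The model system can be solved by quadratures. In the coordinates \<open>u = \<rho> cos \<theta>\<close>,
  \<open>w = - \<rho>\<^sup>n sin \<theta>\<close>, adapted to its scaling symmetry, it reads
  \<open>\<theta>' = \<rho>\<^sup>n\<^sup>-\<^sup>1 \<Theta> \<theta>\<close>, \<open>\<rho>' = \<rho>\<^sup>n R \<theta>\<close>, and \<open>\<Theta> > 0\<close> is the positive definiteness of the quadratic form
  above in \<open>cos\<^sup>n \<theta>\<close> and \<open>sin \<theta>\<close>. Hence \<open>\<theta>\<close> can serve as the independent variable: \<open>\<rho>\<close> is the exponential
  of an antiderivative of \<open>R / \<Theta>\<close>, and time \<open>\<tau>\<close> is an antiderivative of \<open>1 / (\<rho>\<^sup>n\<^sup>-\<^sup>1 \<Theta>)\<close>, which is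
  increasing and can be inverted. The orbit returns at \<open>\<theta> = 2\<pi>\<close>, and in between it stays off the half-line
  \<open>w = 0\<close>, \<open>u \<ge> 0\<close>. It is constructed a little beyond the return.
\<close>

lemma model_system_returns:
  fixes \<alpha> \<beta> :: real and n :: nat
  assumes "\<alpha> > 0" and "\<beta>\<^sup>2 < 4 * real n * \<alpha>" and "n \<ge> 1"
  obtains u w T0 T1 where "0 < T0" "T0 < T1"
    "\<And>t. t \<in> {0..T1} \<Longrightarrow> (u has_real_derivative w t) (at t within {0..T1})"
    "\<And>t. t \<in> {0..T1} \<Longrightarrow>
       (w has_real_derivative - (\<alpha> * u t ^ (2 * n - 1) + \<beta> * u t ^ (n - 1) * w t)) (at t within {0..T1})"
    "u 0 = 1" "w 0 = 0" "w T0 = 0" "u T0 > 0"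
    "\<And>t. 0 < t \<Longrightarrow> t < T0 \<Longrightarrow> w t \<noteq> 0 \<or> u t < 0"
proof -
  define D where "D \<theta> = (cos \<theta>)\<^sup>2 + real n * (sin \<theta>)\<^sup>2" for \<theta> :: real
  define \<Theta> where
    "\<Theta> \<theta> = (\<alpha> * cos \<theta> ^ (2*n) - \<beta> * cos \<theta> ^ n * sin \<theta> + real n * (sin \<theta>)\<^sup>2) / D \<theta>" for \<theta> :: real
  define R where
    "R \<theta> = (- cos \<theta> * sin \<theta> + sin \<theta> * (\<alpha> * cos \<theta> ^ (2*n - 1) - \<beta> * cos \<theta> ^ (n - 1) * sin \<theta>)) / D \<theta>"
    for \<theta> :: real
  have D_pos: "D \<theta> > 0" for \<theta>
  proof -
    have "1 * (sin \<theta>)\<^sup>2 \<le> real n * (sin \<theta>)\<^sup>2"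
      using assms(3) by (intro mult_right_mono) auto
    moreover have "(cos \<theta>)\<^sup>2 + (sin \<theta>)\<^sup>2 = 1" by simp
    ultimately show ?thesis unfolding D_def by linarith
  qed
  have \<Theta>_pos: "\<Theta> \<theta> > 0" for \<theta>
  proof -
    have "cos \<theta> ^ n \<noteq> 0 \<or> sin \<theta> \<noteq> 0"
      by (metis power_not_zero sin_zero_abs_cos_one abs_zero zero_neq_one)
    from quadratic_form_pos[OF assms(1,2) this]
    have "0 < \<alpha> * cos \<theta> ^ (2*n) - \<beta> * cos \<theta> ^ n * sin \<theta> + real n * (sin \<theta>)\<^sup>2"
      by (simp add: power_mult[symmetric] mult.commute)
    then show ?thesis unfolding \<Theta>_def using D_pos by simp
  qed
  have D_ne: "D \<theta> \<noteq> 0" and \<Theta>_ne: "\<Theta> \<theta> \<noteq> 0" for \<theta>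
    using D_pos[of \<theta>] \<Theta>_pos[of \<theta>] by auto
  have cont_D: "continuous_on S D" for S
    unfolding D_def by (intro continuous_intros)
  have cont_\<Theta>: "continuous_on S \<Theta>" for S
    unfolding \<Theta>_def using D_ne by (intro continuous_intros cont_D) auto
  have cont_R: "continuous_on S R" for S
    unfolding R_def using D_ne by (intro continuous_intros cont_D) auto
  \<comment> \<open>Angles from \<open>0\<close> to \<open>7 > 2\<pi>\<close> are used; the margin makes them interior points.\<close>
  let ?I = "{-1..8::real}" and ?J = "{-1<..<8::real}"
  have "continuous_on ?I (\<lambda>\<theta>. R \<theta> / \<Theta> \<theta>)"
    using \<Theta>_ne by (intro continuous_intros cont_R cont_\<Theta>) auto
  from antiderivative_continuous[OF this] obtain G0
    where G0: "\<And>\<theta>. \<theta> \<in> ?I \<Longrightarrow> (G0 has_vector_derivative R \<theta> / \<Theta> \<theta>) (at \<theta> within ?I)"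
    by blast
  define \<rho> where "\<rho> \<theta> = exp (G0 \<theta> - G0 0)" for \<theta>
  have \<rho>_pos: "\<rho> \<theta> > 0" for \<theta> by (simp add: \<rho>_def)
  have at_J: "at \<theta> within ?I = at \<theta>" if "\<theta> \<in> ?J" for \<theta>
    using that by (intro at_within_interior) (auto simp: interior_atLeastAtMost_real)
  have \<rho>_deriv_I: "(\<rho> has_real_derivative \<rho> \<theta> * (R \<theta> / \<Theta> \<theta>)) (at \<theta> within ?I)" if "\<theta> \<in> ?I" for \<theta>
    unfolding \<rho>_def using G0[OF that]
    by (auto simp: has_real_derivative_iff_has_vector_derivative[symmetric] intro!: derivative_eq_intros)
  have cont_\<rho>: "continuous_on ?I \<rho>"
    using \<rho>_deriv_I by (intro DERIV_continuous_on) auto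
  have "continuous_on ?I (\<lambda>\<theta>. 1 / (\<rho> \<theta> ^ (n - 1) * \<Theta> \<theta>))"
    using \<Theta>_ne less_imp_neq[OF \<rho>_pos] by (intro continuous_intros cont_\<rho> cont_\<Theta>) auto
  from antiderivative_continuous[OF this] obtain \<tau>0
    where \<tau>0: "\<And>\<theta>. \<theta> \<in> ?I \<Longrightarrow>
      (\<tau>0 has_vector_derivative 1 / (\<rho> \<theta> ^ (n - 1) * \<Theta> \<theta>)) (at \<theta> within ?I)"
    by blast
  define \<tau> where "\<tau> \<theta> = \<tau>0 \<theta> - \<tau>0 0" for \<theta>
  have \<tau>_deriv: "(\<tau> has_real_derivative 1 / (\<rho> \<theta> ^ (n - 1) * \<Theta> \<theta>)) (at \<theta>)" if "\<theta> \<in> ?J" for \<theta>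
  proof -
    have "(\<tau>0 has_real_derivative 1 / (\<rho> \<theta> ^ (n - 1) * \<Theta> \<theta>)) (at \<theta>)"
      using \<tau>0[of \<theta>] at_J[OF that] that
      by (simp add: has_real_derivative_iff_has_vector_derivative)
    then show ?thesis unfolding \<tau>_def by (auto intro!: derivative_eq_intros)
  qed
  have speed_pos: "1 / (\<rho> \<theta> ^ (n - 1) * \<Theta> \<theta>) > 0" for \<theta>
    using \<rho>_pos \<Theta>_pos by simp
  have \<tau>_less: "\<tau> x < \<tau> y" if "x < y" "x \<in> ?J" "y \<in> ?J" for x y
  proof (rule DERIV_pos_imp_increasing[OF that(1)])
    fix z assume "x \<le> z" "z \<le> y"
    then have "z \<in> ?J" using that by auto
    then show "\<exists>d. (\<tau> has_real_derivative d) (at z) \<and> d > 0"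
      using \<tau>_deriv speed_pos by blast
  qed
  have inj: "inj_on \<tau> ?J"
    by (rule linorder_inj_onI) (use \<tau>_less in force)+
  define \<theta> where "\<theta> = inv_into ?J \<tau>"
  have \<theta>_\<tau>: "\<theta> (\<tau> z) = z" if "z \<in> ?J" for z
    unfolding \<theta>_def using inj that by simp
  have cont_\<tau>: "continuous_on ?J \<tau>"
    by (rule DERIV_continuous_on[OF has_field_derivative_at_within[OF \<tau>_deriv]])
  have \<theta>_deriv: "(\<theta> has_real_derivative \<rho> z ^ (n - 1) * \<Theta> z) (at (\<tau> z))" if "z \<in> ?J" for z
  proof -
    have "(\<theta> has_derivative (*) (\<rho> z ^ (n - 1) * \<Theta> z)) (at (\<tau> z))"
    proof (rule has_derivative_inverse_strong[OF _ that cont_\<tau>])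
      show "(\<tau> has_derivative (*) (1 / (\<rho> z ^ (n - 1) * \<Theta> z))) (at z)"
        using \<tau>_deriv[OF that] by (simp add: has_field_derivative_def)
      show "(*) (1 / (\<rho> z ^ (n - 1) * \<Theta> z)) \<circ> (*) (\<rho> z ^ (n - 1) * \<Theta> z) = id"
        using \<Theta>_ne[of z] \<rho>_pos[of z] by (auto simp: fun_eq_iff)
    qed (use \<theta>_\<tau> in auto)
    then show ?thesis by (simp add: has_field_derivative_def)
  qed
  have \<rho>_deriv: "(\<rho> has_real_derivative \<rho> z * (R z / \<Theta> z)) (at z)" if "z \<in> ?J" for z
    using \<rho>_deriv_I[of z] at_J[OF that] that by simp
  define u where "u t = \<rho> (\<theta> t) * cos (\<theta> t)" for t
  define w where "w t = - (\<rho> (\<theta> t) ^ n * sin (\<theta> t))" for t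
  have two_pi: "2 * pi < 7" using pi_less_4 pi_approx by simp
  define T0 where "T0 = \<tau> (2 * pi)"
  define T1 where "T1 = \<tau> 7"
  have \<tau>0': "\<tau> 0 = 0" by (simp add: \<tau>_def)
  have J: "0 \<in> ?J" "2 * pi \<in> ?J" "7 \<in> ?J" using two_pi pi_gt_zero by (auto intro: less_trans[of _ 0])
  have onto: "\<exists>z. 0 \<le> z \<and> z \<le> 7 \<and> \<tau> z = t" if "t \<in> {0..T1}" for t
    using that \<tau>0' unfolding T1_def
    by (intro IVT') (auto intro!: continuous_on_subset[OF cont_\<tau>])
  have u_deriv: "(u has_real_derivative w t) (at t)" 
    and w_deriv: "(w has_real_derivative - (\<alpha> * u t ^ (2 * n - 1) + \<beta> * u t ^ (n - 1) * w t)) (at t)"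
    if t: "t \<in> {0..T1}" for t
  proof -
    obtain z where z: "0 \<le> z" "z \<le> 7" "\<tau> z = t" using onto[OF t] by blast
    then have zJ: "z \<in> ?J" by auto
    have \<theta>t: "\<theta> t = z" using \<theta>_\<tau>[OF zJ] z by simp
    let ?c = "cos z" and ?s = "sin z" and ?r = "\<rho> z"
    define W where "W = \<alpha> * ?c ^ (2*n) - \<beta> * ?c ^ n * ?s"
    define V where "V = \<alpha> * ?c ^ (2*n - 1) - \<beta> * ?c ^ (n - 1) * ?s"
    have WV: "W = ?c * V" unfolding W_def V_def using assms(3)
      by (cases n) (simp_all add: algebra_simps)
    have T: "\<Theta> z * D z = ?c * V + real n * ?s\<^sup>2"
      using D_ne[of z] by (simp add: \<Theta>_def WV[symmetric] W_def)
    have Rz: "R z * D z = - ?c * ?s + ?s * V"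
      using D_ne[of z] by (simp add: R_def V_def)
    have d\<theta>: "(\<theta> has_real_derivative ?r ^ (n - 1) * \<Theta> z) (at t)"
      using \<theta>_deriv[OF zJ] z by simp
    have "((\<lambda>t. \<rho> (\<theta> t)) has_real_derivative ?r * (R z / \<Theta> z) * (?r ^ (n - 1) * \<Theta> z)) (at t)"
      using DERIV_chain2[OF _ d\<theta>] \<rho>_deriv[OF zJ] \<theta>t by metis
    also have "?r * (R z / \<Theta> z) * (?r ^ (n - 1) * \<Theta> z) = ?r ^ n * R z"
      using \<Theta>_ne[of z] assms(3) by (cases n) simp_all
    finally have d\<rho>: "((\<lambda>t. \<rho> (\<theta> t)) has_real_derivative ?r ^ n * R z) (at t)" .
    have "(u has_real_derivative ?r ^ n * R z * ?c - ?r * ?s * (?r ^ (n - 1) * \<Theta> z)) (at t)"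
      unfolding u_def by (rule derivative_eq_intros d\<rho> d\<theta> refl)+ (simp add: \<theta>t)
    also have "?r ^ n * R z * ?c - ?r * ?s * (?r ^ (n - 1) * \<Theta> z) = ?r ^ n * (R z * ?c - ?s * \<Theta> z)"
      using assms(3) by (cases n) (simp_all add: algebra_simps)
    also have "R z * ?c - ?s * \<Theta> z = - ?s"
    proof -
      have "(R z * ?c - ?s * \<Theta> z) * D z = (R z * D z) * ?c - ?s * (\<Theta> z * D z)"
        by (simp add: algebra_simps)
      also have "\<dots> = - ?s * D z"
        unfolding T Rz by (simp add: D_def algebra_simps power2_eq_square)
      finally show ?thesis by (simp only: mult_right_cancel[OF D_ne[of z]])
    qed
    finally show "(u has_real_derivative w t) (at t)" by (simp add: w_def \<theta>t)
    have "(w has_real_derivative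
        - (real n * (?r ^ n * R z) * ?r ^ (n - 1) * ?s + ?r ^ n * (?c * (?r ^ (n - 1) * \<Theta> z)))) (at t)"
      unfolding w_def by (rule derivative_eq_intros d\<rho> d\<theta> refl)+ (simp add: \<theta>t)
    also have "- (real n * (?r ^ n * R z) * ?r ^ (n - 1) * ?s + ?r ^ n * (?c * (?r ^ (n - 1) * \<Theta> z)))
        = - (?r ^ (2 * n - 1) * (real n * R z * ?s + ?c * \<Theta> z))"
    proof -
      have "2 * n - 1 = n + (n - 1)" using assms(3) by simp
      then show ?thesis by (simp add: power_add algebra_simps)
    qed
    also have "real n * R z * ?s + ?c * \<Theta> z = V"
    proof -
      have "(real n * R z * ?s + ?c * \<Theta> z) * D z = real n * (R z * D z) * ?s + ?c * (\<Theta> z * D z)"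
        by (simp add: algebra_simps)
      also have "\<dots> = V * D z"
        unfolding T Rz by (simp add: D_def algebra_simps power2_eq_square)
      finally show ?thesis by (simp only: mult_right_cancel[OF D_ne[of z]])
    qed
    also have "?r ^ (2 * n - 1) * V = \<alpha> * u t ^ (2 * n - 1) + \<beta> * u t ^ (n - 1) * w t"
    proof -
      have "2 * n - 1 = n + (n - 1)" using assms(3) by simp
      then have "?r ^ (2 * n - 1) = ?r ^ (n - 1) * ?r ^ n" by (simp add: power_add)
      then show ?thesis
        unfolding V_def u_def w_def \<theta>t power_mult_distrib by (simp add: algebra_simps)
    qed
    finally show "(w has_real_derivative - (\<alpha> * u t ^ (2 * n - 1) + \<beta> * u t ^ (n - 1) * w t)) (at t)" .
  qed
  show thesis
  proof (rule that[of T0 T1 u w])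
    show "0 < T0" using \<tau>_less[of 0 "2*pi"] J \<tau>0' by (simp add: T0_def)
    show "T0 < T1" using \<tau>_less[of "2*pi" 7] J two_pi by (simp add: T0_def T1_def)
    have \<theta>0: "\<theta> 0 = 0" using \<theta>_\<tau>[of 0] \<tau>0' by simp
    have \<theta>T0: "\<theta> T0 = 2 * pi" using \<theta>_\<tau>[OF J(2)] by (simp add: T0_def)
    show "u 0 = 1" "w 0 = 0" by (simp_all add: u_def w_def \<theta>0 \<rho>_def)
    show "w T0 = 0" "u T0 > 0" using \<rho>_pos by (simp_all add: u_def w_def \<theta>T0)
    show "(u has_real_derivative w t) (at t within {0..T1})" if "t \<in> {0..T1}" for t
      using u_deriv[OF that] by (rule has_field_derivative_at_within)
    show "(w has_real_derivative - (\<alpha> * u t ^ (2 * n - 1) + \<beta> * u t ^ (n - 1) * w t)) (at t within {0..T1})"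
      if "t \<in> {0..T1}" for t
      using w_deriv[OF that] by (rule has_field_derivative_at_within)
    show "w t \<noteq> 0 \<or> u t < 0" if t: "0 < t" "t < T0" for t
    proof -
      have "t \<in> {0..T1}" using t \<open>T0 < T1\<close> by auto
      then obtain z where z: "0 \<le> z" "z \<le> 7" "\<tau> z = t" using onto by blast
      then have zJ: "z \<in> ?J" by auto
      have "z \<noteq> 0" using z t \<tau>0' by auto
      moreover have "z < 2 * pi"
      proof (rule ccontr)
        assume "\<not> z < 2 * pi"
        then have "T0 \<le> \<tau> z"
          using \<tau>_less[OF _ J(2) zJ] unfolding T0_def by (cases "z = 2 * pi") auto
        then show False using z t by simp
      qed
      ultimately have z': "0 < z" "z < 2 * pi" using z by auto
      have "\<theta> t = z" using \<theta>_\<tau>[OF zJ] z by simp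
      moreover have "cos z < 0" if "sin z = 0"
      proof -
        have "z = pi"
        proof (cases "z < pi")
          case True
          then show ?thesis using sin_gt_zero[of z] z' that by simp
        next
          case False
          then show ?thesis using sin_lt_zero[of z] z' that by (cases "z = pi") auto
        qed
        then show ?thesis by simp
      qed
      ultimately show ?thesis using \<rho>_pos[of z] by (auto simp: u_def w_def mult_less_0_iff)
    qed
  qed
qed

section \<open>Differential inequalities\<close>

lemma deriv_le_imp_diff_le:
  fixes f :: "real \<Rightarrow> real"
  assumes "a \<le> b"
    and "\<And>s. s \<in> {a..b} \<Longrightarrow> (f has_real_derivative f' s) (at s within {a..b})"
    and "\<And>s. s \<in> {a..b} \<Longrightarrow> f' s \<le> C"
  shows "f b - f a \<le> C * (b - a)"
proof (cases "a = b")
  case False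
  then have "a < b" using assms(1) by simp
  then have "\<exists>x\<in>{a<..<b}. f b - f a = f' x * (b - a)"
    using assms(2) by (intro mvt_simple) (auto simp: has_field_derivative_def)
  then show ?thesis using assms(3) \<open>a < b\<close> by (force intro: mult_right_mono)
qed simp

lemma deriv_abs_le_imp_Lipschitz:
  fixes f :: "real \<Rightarrow> real"
  assumes "\<And>s. s \<in> {a..b} \<Longrightarrow> (f has_real_derivative f' s) (at s within {a..b})"
    and "\<And>s. s \<in> {a..b} \<Longrightarrow> \<bar>f' s\<bar> \<le> C"
    and "s \<in> {a..b}" "t \<in> {a..b}"
  shows "\<bar>f s - f t\<bar> \<le> C * \<bar>s - t\<bar>"
  using field_differentiable_bound[of "{a..b}" f f' C t s] assms by (simp add: abs_minus_commute)

text \<open>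
  The functional \<open>\<phi> = (u1 - u2)\<^sup>2 + (w1 - w2)\<^sup>2\<close> satisfies \<open>\<phi>' \<le> k (\<phi> + \<epsilon>\<^sup>2)\<close> with \<open>k = 4L + 2\<close>, so that
  \<open>(\<phi> + \<epsilon>\<^sup>2) exp (- k t)\<close> decreases. Working with the square avoids differentiating a norm. The vector
  fields enter only through the velocities \<open>p\<close>, \<open>r\<close> along the two curves, so the lemma covers
  perturbations that are known only along an orbit.
\<close>

lemma gronwall_planar:
  fixes u1 w1 u2 w2 :: "real \<Rightarrow> real"
  assumes "L \<ge> 1" "\<epsilon> \<ge> 0"
    and u1: "\<And>s. s \<in> {0..S} \<Longrightarrow> (u1 has_real_derivative p1 s) (at s within {0..S})"
    and u2: "\<And>s. s \<in> {0..S} \<Longrightarrow> (u2 has_real_derivative p2 s) (at s within {0..S})"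
    and w1: "\<And>s. s \<in> {0..S} \<Longrightarrow> (w1 has_real_derivative r1 s) (at s within {0..S})"
    and w2: "\<And>s. s \<in> {0..S} \<Longrightarrow> (w2 has_real_derivative r2 s) (at s within {0..S})"
    and p: "\<And>s. s \<in> {0..S} \<Longrightarrow> \<bar>p1 s - p2 s\<bar> \<le> L * (\<bar>u1 s - u2 s\<bar> + \<bar>w1 s - w2 s\<bar>) + \<epsilon>"
    and r: "\<And>s. s \<in> {0..S} \<Longrightarrow> \<bar>r1 s - r2 s\<bar> \<le> L * (\<bar>u1 s - u2 s\<bar> + \<bar>w1 s - w2 s\<bar>) + \<epsilon>"
    and init: "\<bar>u1 0 - u2 0\<bar> + \<bar>w1 0 - w2 0\<bar> \<le> 2 * \<epsilon>"
    and t: "t \<in> {0..S}" "S \<le> T"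
  shows "\<bar>u1 t - u2 t\<bar> \<le> 5 * exp ((4 * L + 2) * T) * \<epsilon> \<and>
         \<bar>w1 t - w2 t\<bar> \<le> 5 * exp ((4 * L + 2) * T) * \<epsilon>"
proof -
  define k where "k = 4 * L + 2"
  have "k \<ge> 1" using \<open>L \<ge> 1\<close> by (simp add: k_def)
  define \<phi> where "\<phi> s = (u1 s - u2 s)\<^sup>2 + (w1 s - w2 s)\<^sup>2" for s
  define \<phi>' where "\<phi>' s = 2 * (u1 s - u2 s) * (p1 s - p2 s) + 2 * (w1 s - w2 s) * (r1 s - r2 s)" for s
  have d\<phi>: "(\<phi> has_real_derivative \<phi>' s) (at s within {0..S})" if "s \<in> {0..S}" for s
    unfolding \<phi>_def \<phi>'_def
    by (rule derivative_eq_intros u1[OF that] u2[OF that] w1[OF that] w2[OF that] refl)+ (simp add: algebra_simps)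
  have \<phi>': "\<phi>' s \<le> k * (\<phi> s + \<epsilon>\<^sup>2)" if s: "s \<in> {0..S}" for s
  proof -
    define x y m where "x = \<bar>u1 s - u2 s\<bar>" and "y = \<bar>w1 s - w2 s\<bar>" and "m = x + y"
    have nn: "x \<ge> 0" "y \<ge> 0" "m \<ge> 0" by (auto simp: x_def y_def m_def)
    have "\<phi>' s \<le> 2 * x * \<bar>p1 s - p2 s\<bar> + 2 * y * \<bar>r1 s - r2 s\<bar>"
      unfolding \<phi>'_def x_def y_def
      using abs_ge_self[of "(u1 s - u2 s) * (p1 s - p2 s)"] abs_ge_self[of "(w1 s - w2 s) * (r1 s - r2 s)"]
      unfolding abs_mult mult.assoc by linarith
    also have "\<dots> \<le> 2 * x * (L * m + \<epsilon>) + 2 * y * (L * m + \<epsilon>)"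
      using p[OF s] r[OF s] nn by (intro add_mono mult_left_mono) (auto simp: x_def y_def m_def)
    also have "\<dots> = 2 * L * m\<^sup>2 + 2 * m * \<epsilon>"
      by (simp add: m_def power2_eq_square algebra_simps)
    also have "\<dots> \<le> (2 * L + 1) * m\<^sup>2 + \<epsilon>\<^sup>2"
      using sum_squares_bound[of m \<epsilon>] by (simp add: algebra_simps)
    also have "m\<^sup>2 \<le> 2 * \<phi> s"
    proof -
      have "m\<^sup>2 \<le> 2 * (x\<^sup>2 + y\<^sup>2)"
        using sum_squares_bound[of x y] by (simp add: m_def power2_eq_square algebra_simps)
      then show ?thesis by (simp add: \<phi>_def x_def y_def)
    qed
    then have "(2 * L + 1) * m\<^sup>2 + \<epsilon>\<^sup>2 \<le> (2 * L + 1) * (2 * \<phi> s) + 1 * \<epsilon>\<^sup>2"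
      using \<open>L \<ge> 1\<close> by (intro add_mono mult_left_mono) auto
    also have "\<dots> \<le> k * \<phi> s + k * \<epsilon>\<^sup>2"
      using \<open>k \<ge> 1\<close> by (intro add_mono mult_right_mono) (auto simp: k_def algebra_simps)
    finally show ?thesis by (simp add: algebra_simps)
  qed
  let ?\<psi> = "\<lambda>s. (\<phi> s + \<epsilon>\<^sup>2) * exp (- k * s)"
  have "?\<psi> t - ?\<psi> 0 \<le> 0 * (t - 0)"
  proof (rule deriv_le_imp_diff_le[where f' = "\<lambda>s. (\<phi>' s - k * (\<phi> s + \<epsilon>\<^sup>2)) * exp (- k * s)"])
    fix s assume "s \<in> {0..t}"
    then have s: "s \<in> {0..S}" using t by auto
    have "(?\<psi> has_real_derivative (\<phi>' s - k * (\<phi> s + \<epsilon>\<^sup>2)) * exp (- k * s)) (at s within {0..S})"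
      by (rule derivative_eq_intros d\<phi>[OF s] refl)+ (simp add: algebra_simps)
    then show "(?\<psi> has_real_derivative (\<phi>' s - k * (\<phi> s + \<epsilon>\<^sup>2)) * exp (- k * s)) (at s within {0..t})"
      by (rule DERIV_subset) (use t in auto)
    show "(\<phi>' s - k * (\<phi> s + \<epsilon>\<^sup>2)) * exp (- k * s) \<le> 0"
      using \<phi>'[OF s] by (intro mult_nonpos_nonneg) auto
  qed (use t in auto)
  then have "(\<phi> t + \<epsilon>\<^sup>2) * exp (- k * t) \<le> \<phi> 0 + \<epsilon>\<^sup>2" by simp
  also have "\<phi> 0 \<le> (2 * \<epsilon>)\<^sup>2"
  proof -
    have "\<phi> 0 \<le> (\<bar>u1 0 - u2 0\<bar> + \<bar>w1 0 - w2 0\<bar>)\<^sup>2"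
      by (simp add: \<phi>_def power2_sum)
    also have "\<dots> \<le> (2 * \<epsilon>)\<^sup>2" using init by (intro power_mono) auto
    finally show ?thesis .
  qed
  finally have "(\<phi> t + \<epsilon>\<^sup>2) * exp (- k * t) \<le> 5 * \<epsilon>\<^sup>2" by (simp add: power_mult_distrib)
  then have "\<phi> t + \<epsilon>\<^sup>2 \<le> 5 * \<epsilon>\<^sup>2 * exp (k * t)"
    by (simp add: exp_minus field_simps)
  also have "\<dots> \<le> 5 * \<epsilon>\<^sup>2 * exp (k * T)"
    using t \<open>k \<ge> 1\<close> by (intro mult_left_mono) auto
  also have "\<dots> = 5 * exp (k * T) * \<epsilon>\<^sup>2" by simp
  finally have "\<phi> t \<le> 5 * exp (k * T) * \<epsilon>\<^sup>2"
    using zero_le_power2[of \<epsilon>] by linarith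
  also have "\<dots> \<le> (5 * exp (k * T))\<^sup>2 * \<epsilon>\<^sup>2"
  proof (rule mult_right_mono)
    have "exp (k * T) \<ge> 1" using t \<open>k \<ge> 1\<close> by simp
    then show "5 * exp (k * T) \<le> (5 * exp (k * T))\<^sup>2"
      by (intro self_le_power) (linarith | simp)+
  qed simp
  finally have le: "\<phi> t \<le> (5 * exp (k * T) * \<epsilon>)\<^sup>2" by (simp add: power_mult_distrib)
  have "(u1 t - u2 t)\<^sup>2 \<le> (5 * exp (k * T) * \<epsilon>)\<^sup>2" "(w1 t - w2 t)\<^sup>2 \<le> (5 * exp (k * T) * \<epsilon>)\<^sup>2"
    using le by (auto simp: \<phi>_def intro: order_trans[rotated])
  then have "\<bar>u1 t - u2 t\<bar> \<le> \<bar>5 * exp (k * T) * \<epsilon>\<bar>" "\<bar>w1 t - w2 t\<bar> \<le> \<bar>5 * exp (k * T) * \<epsilon>\<bar>"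
    by (simp_all only: abs_le_square_iff)
  then show ?thesis using \<open>\<epsilon> \<ge> 0\<close> by (simp add: k_def)
qed

text \<open>
  A bound that improves itself as long as it holds can never be lost: consider the first time at which
  \<open>g\<close> takes the value \<open>1\<close>.
\<close>

lemma continuity_bootstrap:
  fixes g :: "real \<Rightarrow> real"
  assumes cont: "continuous_on {0..S} g" and "g 0 < 1"
    and step: "\<And>t. t \<in> {0..S} \<Longrightarrow> (\<And>s. s \<in> {0..t} \<Longrightarrow> g s \<le> 1) \<Longrightarrow> g t < 1"
    and t: "t \<in> {0..S}"
  shows "g t < 1"
proof (rule ccontr)
  assume "\<not> g t < 1"
  define A where "A = {0..S} \<inter> g -` {1}"
  have hit: "\<exists>x\<in>A. x \<le> s" if s: "s \<in> {0..S}" "g s \<ge> 1" for s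
  proof -
    have "\<exists>x\<ge>0. x \<le> s \<and> g x = 1"
      using s \<open>g 0 < 1\<close> by (intro IVT' continuous_on_subset[OF cont]) auto
    then show ?thesis using s by (force simp: A_def)
  qed
  have "compact A"
    unfolding A_def compact_eq_bounded_closed using continuous_closed_preimage[OF cont, of "{1}"]
    by (auto intro: bounded_subset[of "{0..S}"])
  moreover have "A \<noteq> {}" using hit[OF t] \<open>\<not> g t < 1\<close> by force
  ultimately obtain x where x: "x \<in> A" "\<And>y. y \<in> A \<Longrightarrow> x \<le> y"
    by (meson compact_attains_inf)
  have "g x < 1"
  proof (rule step)
    show "x \<in> {0..S}" using x by (simp add: A_def)
    fix s assume s: "s \<in> {0..x}"
    show "g s \<le> 1"
    proof (rule ccontr)
      assume "\<not> g s \<le> 1"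
      then obtain y where "y \<in> A" "y \<le> s" using hit[of s] s x by (force simp: A_def)
      then have "s = x" using x s by force
      then show False using x \<open>\<not> g s \<le> 1\<close> by (simp add: A_def)
    qed
  qed
  then show False using x by (simp add: A_def)
qed

section \<open>First returns near the model orbit\<close>

definition Lipschitz_on_box :: "real \<Rightarrow> real \<Rightarrow> (real \<Rightarrow> real \<Rightarrow> real) \<Rightarrow> bool" where
  "Lipschitz_on_box M L Q \<longleftrightarrow> (\<forall>u w u' w'. \<bar>u\<bar> \<le> M \<longrightarrow> \<bar>w\<bar> \<le> M \<longrightarrow> \<bar>u'\<bar> \<le> M \<longrightarrow> \<bar>w'\<bar> \<le> M \<longrightarrow>
     \<bar>Q u w - Q u' w'\<bar> \<le> L * (\<bar>u - u'\<bar> + \<bar>w - w'\<bar>))"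

lemma Lipschitz_on_boxD:
  assumes "Lipschitz_on_box M L Q" "\<bar>u\<bar> \<le> M" "\<bar>w\<bar> \<le> M" "\<bar>u'\<bar> \<le> M" "\<bar>w'\<bar> \<le> M"
  shows "\<bar>Q u w - Q u' w'\<bar> \<le> L * (\<bar>u - u'\<bar> + \<bar>w - w'\<bar>)"
  using assms unfolding Lipschitz_on_box_def by blast

text \<open>
  What the comparison uses of the model orbit: one turn from \<open>(1, 0)\<close> back to the positive \<open>u\<close>-axis and a
  little beyond (until \<open>T1\<close>), inside a box with a margin of \<open>1\<close>. The vector field \<open>(w, - q u w)\<close> points
  downwards on the positive \<open>u\<close>-axis, by \<open>q_pos\<close>, so the return is transversal.
\<close>

locale model_orbit =
  fixes q :: "real \<Rightarrow> real \<Rightarrow> real" and u0 w0 :: "real \<Rightarrow> real" and T0 T1 M L :: real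
  assumes T0_pos: "0 < T0" and T0_less: "T0 < T1"
    and u0_deriv: "t \<in> {0..T1} \<Longrightarrow> (u0 has_real_derivative w0 t) (at t within {0..T1})"
    and w0_deriv: "t \<in> {0..T1} \<Longrightarrow> (w0 has_real_derivative - q (u0 t) (w0 t)) (at t within {0..T1})"
    and u0_0: "u0 0 = 1" and w0_0: "w0 0 = 0" and w0_T0: "w0 T0 = 0" and u0_T0: "u0 T0 > 0"
    and avoid: "0 < t \<Longrightarrow> t < T0 \<Longrightarrow> w0 t \<noteq> 0 \<or> u0 t < 0"
    and u0_bound: "t \<in> {0..T1} \<Longrightarrow> \<bar>u0 t\<bar> \<le> M - 1"
    and w0_bound: "t \<in> {0..T1} \<Longrightarrow> \<bar>w0 t\<bar> \<le> M - 1"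
    and L_ge: "L \<ge> 1"
    and q_Lip: "Lipschitz_on_box M L q"
    and q_pos: "x > 0 \<Longrightarrow> q x 0 > 0"
begin

lemma M_ge: "M \<ge> 2"
  using u0_bound[of 0] u0_0 T0_pos T0_less by simp

text \<open>
  Orbits whose field and whose additional errors are at most \<open>\<eta>\<close> off stay within \<open>\<Lambda> * \<eta>\<close> of the model orbit:
  \<open>\<Lambda>\<close> is the Gronwall factor for the interval \<open>{0..T1}\<close>, with total error \<open>2 * \<eta>\<close>.
\<close>

definition \<Lambda> where "\<Lambda> = 10 * exp ((4 * L + 2) * T1)"

lemma \<Lambda>_ge: "\<Lambda> \<ge> 1"
proof -
  have "exp ((4 * L + 2) * T1) \<ge> 1"
    using L_ge T0_pos T0_less by simp
  then show ?thesis unfolding \<Lambda>_def by linarith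
qed

lemma \<Lambda>_pos: "\<Lambda> > 0" using \<Lambda>_ge by simp

text \<open>
  An upper bound for the speed, inside the box, of all orbits under consideration.
\<close>

definition B where "B = \<bar>q 0 0\<bar> + 2 * (L * M) + M + 2"

lemma LM_nonneg: "L * M \<ge> 0"
  using M_ge L_ge by simp

lemma B_pos: "B > 0"
  using M_ge LM_nonneg unfolding B_def by linarith

lemma q_bound:
  assumes "\<bar>x\<bar> \<le> M" "\<bar>y\<bar> \<le> M"
  shows "\<bar>q x y\<bar> \<le> \<bar>q 0 0\<bar> + 2 * (L * M)"
proof -
  have "\<bar>q x y - q 0 0\<bar> \<le> L * (\<bar>x - 0\<bar> + \<bar>y - 0\<bar>)"
    using assms M_ge by (intro Lipschitz_on_boxD[OF q_Lip]) auto
  also have "\<dots> \<le> L * (M + M)"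
    using assms L_ge by (intro mult_left_mono) auto
  also have "\<dots> = 2 * (L * M)" by simp
  finally show ?thesis by linarith
qed

lemma cont_u0: "continuous_on {0..T1} u0"
  using u0_deriv by (rule DERIV_continuous_on)

lemma cont_w0: "continuous_on {0..T1} w0"
  using w0_deriv by (rule DERIV_continuous_on)

lemma cont_q0: "continuous_on {0..T1} (\<lambda>t. q (u0 t) (w0 t))"
proof (rule lipschitz_on_continuous_on[of "L * (2 * B)"], rule lipschitz_onI)
  fix s t assume st: "s \<in> {0..T1}" "t \<in> {0..T1}"
  have "\<bar>u0 s - u0 t\<bar> \<le> B * \<bar>s - t\<bar>"
    using u0_deriv
  proof (rule deriv_abs_le_imp_Lipschitz)
    fix s assume "s \<in> {0..T1}"
    then show "\<bar>w0 s\<bar> \<le> B"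
      using w0_bound[of s] LM_nonneg unfolding B_def by linarith
  qed (use st in auto)
  moreover have "\<bar>w0 s - w0 t\<bar> \<le> B * \<bar>s - t\<bar>"
    using w0_deriv
  proof (rule deriv_abs_le_imp_Lipschitz)
    fix s assume "s \<in> {0..T1}"
    then show "\<bar>- q (u0 s) (w0 s)\<bar> \<le> B"
      using q_bound[of "u0 s" "w0 s"] u0_bound[of s] w0_bound[of s] M_ge unfolding B_def by force
  qed (use st in auto)
  ultimately have "\<bar>u0 s - u0 t\<bar> + \<bar>w0 s - w0 t\<bar> \<le> 2 * B * \<bar>s - t\<bar>" by simp
  then have "L * (\<bar>u0 s - u0 t\<bar> + \<bar>w0 s - w0 t\<bar>) \<le> L * (2 * B * \<bar>s - t\<bar>)"
    using L_ge by (intro mult_left_mono) auto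
  moreover have "\<bar>q (u0 s) (w0 s) - q (u0 t) (w0 t)\<bar> \<le> L * (\<bar>u0 s - u0 t\<bar> + \<bar>w0 s - w0 t\<bar>)"
    using st u0_bound[of s] u0_bound[of t] w0_bound[of s] w0_bound[of t]
    by (intro Lipschitz_on_boxD[OF q_Lip]) auto
  ultimately show "dist (q (u0 s) (w0 s)) (q (u0 t) (w0 t)) \<le> L * (2 * B) * dist s t"
    by (simp add: dist_real_def mult_ac)
qed (use L_ge B_pos in auto)

text \<open>
  Three regimes of the model orbit: on \<open>{0..d}\<close> and near \<open>T0\<close> it moves downwards with definite speed, and
  in between it keeps a definite distance \<open>\<mu>\<close> from the half-line \<open>w = 0\<close>, \<open>u \<ge> 0\<close>, by compactness.
\<close>

lemma transversality_constants:
  obtains c d \<mu> where "c > 0" "d > 0" "2 * d < T0" "T0 + d \<le> T1" "\<mu> > 0"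
    "\<And>s. s \<in> {0..d} \<Longrightarrow> q (u0 s) (w0 s) \<ge> 3 * c"
    "\<And>s. s \<in> {T0 - d..T0 + d} \<Longrightarrow> q (u0 s) (w0 s) \<ge> 3 * c \<and> u0 s \<ge> 3 * c"
    "\<And>s. s \<in> {d..T0 - d} \<Longrightarrow> \<bar>w0 s\<bar> \<ge> \<mu> \<or> u0 s \<le> - \<mu>"
    "w0 (T0 - d) \<ge> 3 * c * d" "w0 (T0 + d) \<le> - (3 * c * d)"
proof -
  \<comment> \<open>The factor \<open>6\<close> leaves room: by continuity \<open>3c\<close> is a lower bound nearby, and \<open>2c\<close> remains one for
      the perturbed orbits.\<close>
  define c where "c = min (q 1 0) (min (q (u0 T0) 0) (u0 T0)) / 6"
  have "c > 0" using q_pos[of 1] q_pos[OF u0_T0] u0_T0 by (simp add: c_def)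
  have c6: "q 1 0 \<ge> 6 * c" "q (u0 T0) 0 \<ge> 6 * c" "u0 T0 \<ge> 6 * c" by (simp_all add: c_def)
  have near: "\<exists>d>0. \<forall>s\<in>{0..T1}. \<bar>s - t\<bar> < d \<longrightarrow> g s > 3 * c"
    if g: "continuous_on {0..T1} g" "t \<in> {0..T1}" "g t \<ge> 6 * c" for g :: "real \<Rightarrow> real" and t
  proof -
    obtain d where "d > 0" "\<forall>s\<in>{0..T1}. dist s t < d \<longrightarrow> dist (g s) (g t) < 3 * c"
      using g(1,2) \<open>c > 0\<close> unfolding continuous_on_iff by (metis mult_pos_pos zero_less_numeral)
    moreover have "g s > 3 * c" if "dist (g s) (g t) < 3 * c" for s
      using that g(3) unfolding dist_real_def by linarith
    ultimately show ?thesis by (auto simp: dist_real_def)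
  qed
  obtain d1 where d1: "d1 > 0" "\<And>s. s \<in> {0..T1} \<Longrightarrow> \<bar>s - 0\<bar> < d1 \<Longrightarrow> q (u0 s) (w0 s) > 3 * c"
    using near[OF cont_q0, of 0] c6 T0_pos T0_less by (auto simp: u0_0 w0_0)
  obtain d2 where d2: "d2 > 0" "\<And>s. s \<in> {0..T1} \<Longrightarrow> \<bar>s - T0\<bar> < d2 \<Longrightarrow> q (u0 s) (w0 s) > 3 * c"
    using near[OF cont_q0, of T0] c6 T0_pos T0_less by (auto simp: w0_T0)
  obtain d3 where d3: "d3 > 0" "\<And>s. s \<in> {0..T1} \<Longrightarrow> \<bar>s - T0\<bar> < d3 \<Longrightarrow> u0 s > 3 * c"
    using near[OF cont_u0, of T0] c6 T0_pos T0_less by auto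
  define e where "e = min (min d1 d2) (min d3 (min T0 (T1 - T0)))"
  have e: "e > 0" "e \<le> d1" "e \<le> d2" "e \<le> d3" "e \<le> T0" "e \<le> T1 - T0"
    using d1(1) d2(1) d3(1) T0_pos T0_less by (simp_all add: e_def)
  define d where "d = e / 3"
  have d: "d > 0" "d < d1" "d < d2" "d < d3" "2 * d < T0" "T0 + d \<le> T1"
    using e unfolding d_def by simp_all
  have start: "q (u0 s) (w0 s) \<ge> 3 * c" if "s \<in> {0..d}" for s
    using d1(2)[of s] that d T0_less by auto
  have fin: "q (u0 s) (w0 s) \<ge> 3 * c \<and> u0 s \<ge> 3 * c" if "s \<in> {T0 - d..T0 + d}" for s
  proof -
    have "s \<in> {0..T1}" "\<bar>s - T0\<bar> \<le> d" using that d by auto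
    then show ?thesis using d2(2)[of s] d3(2)[of s] d by auto
  qed
  have "\<exists>x\<in>{d..T0 - d}. \<forall>s\<in>{d..T0 - d}. max \<bar>w0 x\<bar> (- u0 x) \<le> max \<bar>w0 s\<bar> (- u0 s)"
  proof (rule continuous_attains_inf)
    have "{d..T0 - d} \<subseteq> {0..T1}" using d T0_less by auto
    then show "continuous_on {d..T0 - d} (\<lambda>s. max \<bar>w0 s\<bar> (- u0 s))"
      by (intro continuous_intros continuous_on_subset[OF cont_w0] continuous_on_subset[OF cont_u0])
  qed (use d in auto)
  then obtain x where x: "x \<in> {d..T0 - d}"
    "\<And>s. s \<in> {d..T0 - d} \<Longrightarrow> max \<bar>w0 x\<bar> (- u0 x) \<le> max \<bar>w0 s\<bar> (- u0 s)" by blast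
  define \<mu> where "\<mu> = max \<bar>w0 x\<bar> (- u0 x)"
  have "\<mu> > 0" using avoid[of x] x(1) d by (auto simp: \<mu>_def less_max_iff_disj)
  have away: "\<bar>w0 s\<bar> \<ge> \<mu> \<or> u0 s \<le> - \<mu>" if "s \<in> {d..T0 - d}" for s
    using x(2)[OF that] unfolding \<mu>_def[symmetric] by (auto simp: le_max_iff_disj)
  have slope: "w0 t - w0 s \<le> - (3 * c) * (t - s)" if "T0 - d \<le> s" "s \<le> t" "t \<le> T0 + d" for s t
  proof (rule deriv_le_imp_diff_le[OF that(2)])
    fix r assume r: "r \<in> {s..t}"
    then have "r \<in> {0..T1}" using that d by auto
    from w0_deriv[OF this] show "(w0 has_real_derivative - q (u0 r) (w0 r)) (at r within {s..t})"
      by (rule DERIV_subset) (use that d in auto)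
    show "- q (u0 r) (w0 r) \<le> - (3 * c)" using fin[of r] r that by auto
  qed
  show thesis
  proof (rule that[OF \<open>c > 0\<close> d(1,5,6) \<open>\<mu> > 0\<close> start fin away])
    show "w0 (T0 - d) \<ge> 3 * c * d" using slope[of "T0 - d" T0] d w0_T0 by simp
    show "w0 (T0 + d) \<le> - (3 * c * d)" using slope[of T0 "T0 + d"] d w0_T0 by simp
  qed
qed

end

text \<open>
  A rescaled orbit up to its first return, with the perturbation recorded only by its values \<open>e1\<close>,
  \<open>e2\<close> along the orbit. The section is where \<open>u' = w + e1\<close> vanishes. All information about the
  perturbation is restricted to times when the orbit is in the box of radius \<open>M\<close>, because outside of it
  nothing is known about the original system; for small perturbations \<open>in_box\<close> removes the restriction.
  The Lipschitz bound \<open>e1_Lip\<close> says that the section is almost horizontal.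
\<close>

locale scaled_return =
  fixes Q :: "real \<Rightarrow> real \<Rightarrow> real" and M \<epsilon> :: real and u w e1 e2 :: "real \<Rightarrow> real" and \<sigma> :: real
  assumes \<sigma>_pos: "\<sigma> > 0"
    and u_0: "u 0 = 1" and w_0: "w 0 + e1 0 = 0" and w_0_bound: "\<bar>w 0\<bar> \<le> M"
    and u_deriv: "s \<in> {0..\<sigma>} \<Longrightarrow> (u has_real_derivative w s + e1 s) (at s within {0..\<sigma>})"
    and w_deriv: "s \<in> {0..\<sigma>} \<Longrightarrow> (w has_real_derivative - Q (u s) (w s) + e2 s) (at s within {0..\<sigma>})"
    and e_bound: "s \<in> {0..\<sigma>} \<Longrightarrow> \<bar>u s\<bar> \<le> M \<Longrightarrow> \<bar>w s\<bar> \<le> M \<Longrightarrow> \<bar>e1 s\<bar> \<le> \<epsilon> \<and> \<bar>e2 s\<bar> \<le> \<epsilon>"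
    and e1_Lip: "s \<in> {0..\<sigma>} \<Longrightarrow> \<bar>u s\<bar> \<le> M \<Longrightarrow> \<bar>w s\<bar> \<le> M \<Longrightarrow>
      t \<in> {0..\<sigma>} \<Longrightarrow> \<bar>u t\<bar> \<le> M \<Longrightarrow> \<bar>w t\<bar> \<le> M \<Longrightarrow>
      \<bar>e1 s - e1 t\<bar> \<le> \<epsilon> * (\<bar>u s - u t\<bar> + \<bar>w s - w t\<bar>)"
    and u_\<sigma>: "u \<sigma> > 0"
    and w_\<sigma>: "\<bar>u \<sigma>\<bar> \<le> M \<Longrightarrow> \<bar>w \<sigma>\<bar> \<le> M \<Longrightarrow> w \<sigma> + e1 \<sigma> = 0"
    and first: "0 < s \<Longrightarrow> s < \<sigma> \<Longrightarrow> \<bar>u s\<bar> \<le> M \<Longrightarrow> \<bar>w s\<bar> \<le> M \<Longrightarrow> u s > 0 \<Longrightarrow> w s + e1 s \<noteq> 0"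

locale perturbed_orbit = model_orbit q u0 w0 T0 T1 M L + scaled_return Q M \<epsilon> u w e1 e2 \<sigma>
  for q u0 w0 T0 T1 M L Q \<epsilon> u w e1 e2 \<sigma> +
  fixes \<eta> :: real
  assumes Q_Lip: "Lipschitz_on_box M L Q"
    and Q_near: "\<bar>x\<bar> \<le> M \<Longrightarrow> \<bar>y\<bar> \<le> M \<Longrightarrow> \<bar>Q x y - q x y\<bar> \<le> \<eta>"
    and \<epsilon>_nonneg: "0 \<le> \<epsilon>" and \<epsilon>_le: "\<epsilon> \<le> \<eta>" and \<eta>_small: "\<Lambda> * \<eta> < 1"
begin

lemma \<eta>_nonneg: "\<eta> \<ge> 0" using \<epsilon>_nonneg \<epsilon>_le by simp

lemma \<eta>_less_1: "\<eta> < 1"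
proof -
  have "1 * \<eta> \<le> \<Lambda> * \<eta>"
    using \<eta>_nonneg \<Lambda>_ge by (rule mult_right_mono[rotated])
  then show ?thesis using \<eta>_small by simp
qed

text \<open>
  Gronwall applies only inside the box, and being in the box follows from the estimate; the
  circle is broken by \<open>continuity_bootstrap\<close>.
\<close>

lemma tube:
  assumes "t \<in> {0..min \<sigma> T1}"
  shows "\<bar>u t - u0 t\<bar> \<le> \<Lambda> * \<eta>" and "\<bar>w t - w0 t\<bar> \<le> \<Lambda> * \<eta>"
proof -
  define S where "S = min \<sigma> T1"
  have S: "0 \<le> S" "S \<le> \<sigma>" "S \<le> T1" using \<sigma>_pos T0_pos T0_less by (auto simp: S_def)
  define g where "g s = max \<bar>u s - u0 s\<bar> \<bar>w s - w0 s\<bar>" for s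
  have est: "g t \<le> \<Lambda> * \<eta>" if t: "t \<in> {0..S}" and le: "\<And>s. s \<in> {0..t} \<Longrightarrow> g s \<le> 1" for t
  proof -
    have sub: "{0..t} \<subseteq> {0..\<sigma>}" "{0..t} \<subseteq> {0..T1}" using t S by auto
    have box: "\<bar>u s\<bar> \<le> M" "\<bar>w s\<bar> \<le> M" "\<bar>u0 s\<bar> \<le> M" "\<bar>w0 s\<bar> \<le> M" if "s \<in> {0..t}" for s
      using le[OF that] u0_bound[of s] w0_bound[of s] that sub by (auto simp: g_def)
    have e: "\<bar>e1 s\<bar> \<le> \<eta>" "\<bar>e2 s\<bar> \<le> \<eta>" if "s \<in> {0..t}" for s
      using e_bound[of s] box[OF that] that sub \<epsilon>_le by force+
    have "\<bar>u t - u0 t\<bar> \<le> 5 * exp ((4 * L + 2) * T1) * (2 * \<eta>) \<and>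
          \<bar>w t - w0 t\<bar> \<le> 5 * exp ((4 * L + 2) * T1) * (2 * \<eta>)"
    proof (rule gronwall_planar[where S = t and ?u1.0 = u and ?u2.0 = u0 and ?w1.0 = w and ?w2.0 = w0 and ?p1.0 = "\<lambda>s. w s + e1 s" and ?p2.0 = w0
          and ?r1.0 = "\<lambda>s. - Q (u s) (w s) + e2 s" and ?r2.0 = "\<lambda>s. - q (u0 s) (w0 s)"])
      fix s assume s: "s \<in> {0..t}"
      show "(u has_real_derivative w s + e1 s) (at s within {0..t})"
        using u_deriv sub s by (meson DERIV_subset subsetD)
      show "(w has_real_derivative - Q (u s) (w s) + e2 s) (at s within {0..t})"
        using w_deriv sub s by (meson DERIV_subset subsetD)
      show "(u0 has_real_derivative w0 s) (at s within {0..t})"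
        using u0_deriv sub s by (meson DERIV_subset subsetD)
      show "(w0 has_real_derivative - q (u0 s) (w0 s)) (at s within {0..t})"
        using w0_deriv sub s by (meson DERIV_subset subsetD)
      have "1 * (\<bar>u s - u0 s\<bar> + \<bar>w s - w0 s\<bar>) \<le> L * (\<bar>u s - u0 s\<bar> + \<bar>w s - w0 s\<bar>)"
        using L_ge by (intro mult_right_mono) auto
      then have "\<bar>w s - w0 s\<bar> \<le> L * (\<bar>u s - u0 s\<bar> + \<bar>w s - w0 s\<bar>)" by simp
      moreover have "\<bar>w s + e1 s - w0 s\<bar> \<le> \<bar>w s - w0 s\<bar> + \<bar>e1 s\<bar>" by linarith
      ultimately show "\<bar>w s + e1 s - w0 s\<bar> \<le> L * (\<bar>u s - u0 s\<bar> + \<bar>w s - w0 s\<bar>) + 2 * \<eta>"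
        using e(1)[OF s] \<eta>_nonneg by simp
      have "\<bar>Q (u s) (w s) - q (u s) (w s)\<bar> \<le> \<eta>"
        using Q_near box[OF s] by simp
      moreover have "\<bar>q (u s) (w s) - q (u0 s) (w0 s)\<bar> \<le> L * (\<bar>u s - u0 s\<bar> + \<bar>w s - w0 s\<bar>)"
        by (rule Lipschitz_on_boxD[OF q_Lip box[OF s]])
      moreover have "\<bar>- Q (u s) (w s) + e2 s - - q (u0 s) (w0 s)\<bar>
          \<le> \<bar>Q (u s) (w s) - q (u s) (w s)\<bar> + \<bar>q (u s) (w s) - q (u0 s) (w0 s)\<bar> + \<bar>e2 s\<bar>"
        by linarith
      ultimately show "\<bar>- Q (u s) (w s) + e2 s - - q (u0 s) (w0 s)\<bar>
          \<le> L * (\<bar>u s - u0 s\<bar> + \<bar>w s - w0 s\<bar>) + 2 * \<eta>"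
        using e(2)[OF s] by simp
    next
      have "w 0 = - e1 0" using w_0 by simp
      then show "\<bar>u 0 - u0 0\<bar> + \<bar>w 0 - w0 0\<bar> \<le> 2 * (2 * \<eta>)"
        using e[of 0] t \<eta>_nonneg by (simp add: u_0 u0_0 w0_0)
    qed (use t S \<eta>_nonneg L_ge in auto)
    then show ?thesis by (simp add: g_def \<Lambda>_def)
  qed
  have "g s < 1" if "s \<in> {0..S}" for s
  proof (rule continuity_bootstrap[OF _ _ _ that])
    have "continuous_on {0..\<sigma>} u" using u_deriv by (rule DERIV_continuous_on)
    moreover have "continuous_on {0..\<sigma>} w" using w_deriv by (rule DERIV_continuous_on)
    ultimately show "continuous_on {0..S} g"
      unfolding g_def using cont_u0 cont_w0 S
      by (intro continuous_intros) (auto elim!: continuous_on_subset)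
    have "w 0 = - e1 0" using w_0 by simp
    then have "\<bar>w 0\<bar> \<le> \<eta>" using e_bound[of 0] w_0_bound u_0 M_ge \<sigma>_pos \<epsilon>_le by auto
    then show "g 0 < 1" using \<eta>_less_1 by (simp add: g_def u_0 u0_0 w0_0)
    show "g t < 1" if "t \<in> {0..S}" "\<And>s. s \<in> {0..t} \<Longrightarrow> g s \<le> 1" for t
      using est[OF that] \<eta>_small by simp
  qed
  then have "g t \<le> \<Lambda> * \<eta>"
    using assms by (intro est) (auto simp: S_def intro!: less_imp_le)
  then show "\<bar>u t - u0 t\<bar> \<le> \<Lambda> * \<eta>" "\<bar>w t - w0 t\<bar> \<le> \<Lambda> * \<eta>" by (auto simp: g_def)
qed

lemma in_box:
  assumes "t \<in> {0..min \<sigma> T1}"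
  shows "\<bar>u t\<bar> \<le> M" and "\<bar>w t\<bar> \<le> M" and "\<bar>e1 t\<bar> \<le> \<epsilon>" and "\<bar>e2 t\<bar> \<le> \<epsilon>"
proof -
  show "\<bar>u t\<bar> \<le> M" "\<bar>w t\<bar> \<le> M"
    using tube[OF assms] \<eta>_small u0_bound[of t] w0_bound[of t] assms by auto
  then show "\<bar>e1 t\<bar> \<le> \<epsilon>" "\<bar>e2 t\<bar> \<le> \<epsilon>" using e_bound[of t] assms by auto
qed

lemma velocity_near:
  assumes "t \<in> {0..min \<sigma> T1}"
  shows "\<bar>(- Q (u t) (w t) + e2 t) - (- q (u0 t) (w0 t))\<bar> \<le> (2 * L * \<Lambda> + 2) * \<eta>"
proof -
  have "\<bar>Q (u t) (w t) - q (u t) (w t)\<bar> \<le> \<eta>"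
    using Q_near in_box[OF assms] by simp
  moreover have "\<bar>q (u t) (w t) - q (u0 t) (w0 t)\<bar> \<le> 2 * L * \<Lambda> * \<eta>"
  proof -
    have "\<bar>q (u t) (w t) - q (u0 t) (w0 t)\<bar> \<le> L * (\<bar>u t - u0 t\<bar> + \<bar>w t - w0 t\<bar>)"
      by (rule Lipschitz_on_boxD[OF q_Lip in_box(1,2)[OF assms]])
         (use u0_bound[of t] w0_bound[of t] assms in auto)
    also have "\<dots> \<le> L * (\<Lambda> * \<eta> + \<Lambda> * \<eta>)"
      by (rule mult_left_mono[OF add_mono[OF tube[OF assms]]]) (use L_ge in simp)
    finally show ?thesis by (simp add: mult_ac)
  qed
  moreover have "\<bar>(- Q (u t) (w t) + e2 t) - (- q (u0 t) (w0 t))\<bar>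
      \<le> \<bar>Q (u t) (w t) - q (u t) (w t)\<bar> + \<bar>q (u t) (w t) - q (u0 t) (w0 t)\<bar> + \<bar>e2 t\<bar>"
    by linarith
  ultimately have "\<bar>(- Q (u t) (w t) + e2 t) - (- q (u0 t) (w0 t))\<bar> \<le> 2 * L * \<Lambda> * \<eta> + 2 * \<eta>"
    using in_box(4)[OF assms] \<epsilon>_le by simp
  then show ?thesis by (simp add: algebra_simps)
qed

lemma speed_bound:
  assumes "s \<in> {0..min \<sigma> T1}" "t \<in> {0..min \<sigma> T1}"
  shows "\<bar>u s - u t\<bar> \<le> B * \<bar>s - t\<bar>" and "\<bar>w s - w t\<bar> \<le> B * \<bar>s - t\<bar>"
proof -
  let ?I = "{0..min \<sigma> T1}"
  show "\<bar>u s - u t\<bar> \<le> B * \<bar>s - t\<bar>"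
  proof (rule deriv_abs_le_imp_Lipschitz[OF _ _ assms])
    fix r assume r: "r \<in> ?I"
    show "(u has_real_derivative w r + e1 r) (at r within ?I)"
      using DERIV_subset[OF u_deriv[of r]] r by auto
    show "\<bar>w r + e1 r\<bar> \<le> B"
      using in_box[OF r] \<epsilon>_le \<eta>_less_1 LM_nonneg unfolding B_def by linarith
  qed
  show "\<bar>w s - w t\<bar> \<le> B * \<bar>s - t\<bar>"
  proof (rule deriv_abs_le_imp_Lipschitz[OF _ _ assms])
    fix r assume r: "r \<in> ?I"
    show "(w has_real_derivative - Q (u r) (w r) + e2 r) (at r within ?I)"
      using DERIV_subset[OF w_deriv[of r]] r by auto
    show "\<bar>- Q (u r) (w r) + e2 r\<bar> \<le> B"
      using in_box(4)[OF r] \<epsilon>_le \<eta>_less_1 q_bound[OF in_box(1,2)[OF r]] Q_near[OF in_box(1,2)[OF r]] M_ge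
      unfolding B_def by linarith
  qed
qed

lemma descent:
  assumes "0 \<le> s" "s \<le> t" "t \<le> min \<sigma> T1" "(2 * L * \<Lambda> + 2) * \<eta> \<le> c"
    and "\<And>r. r \<in> {s..t} \<Longrightarrow> q (u0 r) (w0 r) \<ge> 3 * c"
  shows "w t - w s \<le> - (2 * c) * (t - s)"
proof (rule deriv_le_imp_diff_le[OF assms(2)])
  fix r assume r: "r \<in> {s..t}"
  show "(w has_real_derivative - Q (u r) (w r) + e2 r) (at r within {s..t})"
    using DERIV_subset[OF w_deriv[of r]] r assms by auto
  show "- Q (u r) (w r) + e2 r \<le> - (2 * c)"
    using velocity_near[of r] assms(4) assms(5)[OF r] r assms(1-3) by auto
qed

text \<open>
  Before \<open>T0 - d\<close> no return is possible. After time \<open>d\<close> this holds because the model orbit is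
  away from the section. During \<open>{0..d}\<close> the orbit falls by at least \<open>2c\<sigma>\<close>, while along the section
  the height could change by at most \<open>2B\<eta>\<sigma>\<close>, the variation of \<open>e1\<close>. On the other hand \<open>w + e1\<close> changes
  sign between \<open>T0 - d\<close> and \<open>T0 + d\<close>, which forces a return there, so the first one is not later.
\<close>

lemma return_time_near:
  assumes "c > 0" "d > 0" "2 * d < T0" "T0 + d \<le> T1" "\<mu> > 0"
    and start: "\<And>s. s \<in> {0..d} \<Longrightarrow> q (u0 s) (w0 s) \<ge> 3 * c"
    and fin: "\<And>s. s \<in> {T0 - d..T0 + d} \<Longrightarrow> q (u0 s) (w0 s) \<ge> 3 * c \<and> u0 s \<ge> 3 * c"
    and away: "\<And>s. s \<in> {d..T0 - d} \<Longrightarrow> \<bar>w0 s\<bar> \<ge> \<mu> \<or> u0 s \<le> - \<mu>"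
    and cross: "w0 (T0 - d) \<ge> 3 * c * d" "w0 (T0 + d) \<le> - (3 * c * d)"
    and small: "(2 * L * \<Lambda> + 2) * \<eta> \<le> c" "(\<Lambda> + 1) * \<eta> < \<mu>" "(\<Lambda> + 1) * \<eta> < 3 * c * d"
      "\<Lambda> * \<eta> < 3 * c" "B * \<eta> < c"
  shows "\<sigma> \<in> {T0 - d..T0 + d}"
proof -
  have small': "\<Lambda> * \<eta> + \<eta> < \<mu>" "\<Lambda> * \<eta> + \<eta> < 3 * c * d"
    using small(2,3) by (simp_all add: algebra_simps)
  have "\<sigma> \<ge> T0 - d"
  proof (rule ccontr)
    assume "\<not> \<sigma> \<ge> T0 - d"
    then have less: "\<sigma> < T0 - d" by simp
    have \<sigma>: "\<sigma> \<in> {0..min \<sigma> T1}" and z: "0 \<in> {0..min \<sigma> T1}"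
      using less \<sigma>_pos T0_less assms by auto
    have w\<sigma>: "w \<sigma> = - e1 \<sigma>" using w_\<sigma> in_box[OF \<sigma>] by simp
    have "\<bar>w0 \<sigma>\<bar> < \<mu>"
      using tube(2)[OF \<sigma>] in_box(3)[OF \<sigma>] w\<sigma> small' \<epsilon>_le by linarith
    moreover have "u0 \<sigma> > - \<mu>"
      using tube(1)[OF \<sigma>] u_\<sigma> small' \<eta>_nonneg by linarith
    ultimately have "\<sigma> < d" using away[of \<sigma>] less by force
    then have "w \<sigma> - w 0 \<le> - (2 * c) * (\<sigma> - 0)"
      using \<sigma> \<sigma>_pos small(1) by (intro descent start) auto
    moreover have "w 0 = - e1 0" using w_0 by simp
    ultimately have "2 * c * \<sigma> \<le> \<bar>e1 \<sigma> - e1 0\<bar>" using w\<sigma> by simp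
    also have "\<dots> \<le> \<epsilon> * (\<bar>u \<sigma> - u 0\<bar> + \<bar>w \<sigma> - w 0\<bar>)"
      by (rule e1_Lip[OF _ in_box(1,2)[OF \<sigma>] _ in_box(1,2)[OF z]]) (use \<sigma>_pos in simp_all)
    also have "\<dots> \<le> \<eta> * (B * \<bar>\<sigma> - 0\<bar> + B * \<bar>\<sigma> - 0\<bar>)"
      by (rule mult_mono[OF \<epsilon>_le add_mono[OF speed_bound[OF \<sigma> z]]]) (use \<eta>_nonneg in simp_all)
    also have "\<dots> = 2 * (B * \<eta>) * \<sigma>" using \<sigma>_pos by (simp add: algebra_simps)
    also have "\<dots> < 2 * c * \<sigma>" using small(5) \<sigma>_pos by simp
    finally show False by simp
  qed
  moreover have "\<sigma> \<le> T0 + d"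
  proof (rule ccontr)
    assume "\<not> \<sigma> \<le> T0 + d"
    then have gr: "\<sigma> > T0 + d" by simp
    have sub: "s \<in> {0..min \<sigma> T1}" if "s \<in> {T0 - d..T0 + d}" for s
      using that assms(2-4) gr by auto
    have ends: "T0 - d \<in> {T0 - d..T0 + d}" "T0 + d \<in> {T0 - d..T0 + d}" using assms by auto
    have "(2 * B)-lipschitz_on {T0 - d..T0 + d} e1"
    proof (rule lipschitz_onI)
      fix s t assume "s \<in> {T0 - d..T0 + d}" "t \<in> {T0 - d..T0 + d}"
      then have st: "s \<in> {0..min \<sigma> T1}" "t \<in> {0..min \<sigma> T1}" by (blast dest: sub)+
      have "\<bar>e1 s - e1 t\<bar> \<le> \<epsilon> * (\<bar>u s - u t\<bar> + \<bar>w s - w t\<bar>)"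
        by (rule e1_Lip[OF _ in_box(1,2)[OF st(1)] _ in_box(1,2)[OF st(2)]]) (use st in simp_all)
      also have "\<dots> \<le> 1 * (B * \<bar>s - t\<bar> + B * \<bar>s - t\<bar>)"
      proof (rule mult_mono)
        show "\<bar>u s - u t\<bar> + \<bar>w s - w t\<bar> \<le> B * \<bar>s - t\<bar> + B * \<bar>s - t\<bar>"
          using speed_bound[OF st] by (rule add_mono)
      qed (use \<epsilon>_le \<eta>_less_1 in simp_all)
      finally show "dist (e1 s) (e1 t) \<le> 2 * B * dist s t" by (simp add: dist_real_def mult_ac)
    qed (use B_pos in simp)
    then have "continuous_on {T0 - d..T0 + d} e1" by (rule lipschitz_on_continuous_on)
    moreover have "continuous_on {T0 - d..T0 + d} w"
    proof -
      have "continuous_on {0..\<sigma>} w" using w_deriv by (rule DERIV_continuous_on)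
      then show ?thesis by (rule continuous_on_subset) (use assms(2,3) gr in auto)
    qed
    ultimately have cont: "continuous_on {T0 - d..T0 + d} (\<lambda>s. w s + e1 s)"
      by (intro continuous_intros)
    have "\<exists>s\<ge>T0 - d. s \<le> T0 + d \<and> w s + e1 s = 0"
    proof (rule IVT2'[OF _ _ _ cont])
      show "w (T0 + d) + e1 (T0 + d) \<le> 0"
        using tube(2)[OF sub[OF ends(2)]] in_box(3)[OF sub[OF ends(2)]] cross small' \<epsilon>_le
        by linarith
      show "0 \<le> w (T0 - d) + e1 (T0 - d)"
        using tube(2)[OF sub[OF ends(1)]] in_box(3)[OF sub[OF ends(1)]] cross small' \<epsilon>_le
        by linarith
    qed (use assms in auto)
    then obtain s where s: "s \<in> {T0 - d..T0 + d}" "w s + e1 s = 0" by auto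
    have "u s > 0" using tube[OF sub[OF s(1)]] fin[OF s(1)] small(4) by auto
    then show False
      using first[of s] in_box[OF sub[OF s(1)]] s assms(2,3) gr by auto
  qed
  ultimately show ?thesis by simp
qed

end

text \<open>
  The threshold \<open>\<eta>\<close> and the constant \<open>K\<close> depend only on the data of \<open>model_orbit\<close>; this uniformity in the field
  \<open>Q\<close> is what allows the scaling parameter to tend to \<open>0\<close>. Let \<open>\<sigma> \<le> \<sigma>'\<close>. At time \<open>\<sigma>\<close> both orbits are
  within \<open>O(\<epsilon>)\<close> of each other, so the second one is at height \<open>O(\<epsilon>)\<close>; as it falls with speed at least
  \<open>2c\<close> until its own return, \<open>\<sigma>' - \<sigma> = O(\<epsilon>)\<close>.
\<close>

theorem (in model_orbit) returns_close:
  obtains \<eta> K where "\<eta> > 0" "K \<ge> 0"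
    "\<And>Q \<epsilon> u w e1 e2 \<sigma> u' w' e1' e2' \<sigma>'.
       Lipschitz_on_box M L Q \<Longrightarrow> (\<And>x y. \<bar>x\<bar> \<le> M \<Longrightarrow> \<bar>y\<bar> \<le> M \<Longrightarrow> \<bar>Q x y - q x y\<bar> \<le> \<eta>) \<Longrightarrow>
       0 \<le> \<epsilon> \<Longrightarrow> \<epsilon> \<le> \<eta> \<Longrightarrow>
       scaled_return Q M \<epsilon> u w e1 e2 \<sigma> \<Longrightarrow> scaled_return Q M \<epsilon> u' w' e1' e2' \<sigma>' \<Longrightarrow>
       \<bar>u \<sigma> - u' \<sigma>'\<bar> \<le> K * \<epsilon>"
proof -
  obtain c d \<mu> where c: "c > 0" "d > 0" "2 * d < T0" "T0 + d \<le> T1" "\<mu> > 0"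
    and start: "\<And>s. s \<in> {0..d} \<Longrightarrow> q (u0 s) (w0 s) \<ge> 3 * c"
    and fin: "\<And>s. s \<in> {T0 - d..T0 + d} \<Longrightarrow> q (u0 s) (w0 s) \<ge> 3 * c \<and> u0 s \<ge> 3 * c"
    and away: "\<And>s. s \<in> {d..T0 - d} \<Longrightarrow> \<bar>w0 s\<bar> \<ge> \<mu> \<or> u0 s \<le> - \<mu>"
    and cross: "w0 (T0 - d) \<ge> 3 * c * d" "w0 (T0 + d) \<le> - (3 * c * d)"
    using transversality_constants by blast
  \<comment> \<open>\<open>A\<close> bounds every factor of \<open>\<eta>\<close> in the smallness conditions, and \<open>m\<close> bounds their right-hand
      sides from below.\<close>
  define A where "A = \<Lambda> + 2 * L * \<Lambda> + 2 + B"
  define m where "m = min (min 1 c) (min \<mu> (3 * c * d))"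
  have "m > 0" using c by (simp add: m_def)
  have L\<Lambda>: "L * \<Lambda> > 0" using L_ge \<Lambda>_pos by simp
  have "A > 0" using \<Lambda>_pos L\<Lambda> B_pos by (simp add: A_def)
  define \<eta> where "\<eta> = m / (2 * A)"
  have "\<eta> > 0" using \<open>m > 0\<close> \<open>A > 0\<close> by (simp add: \<eta>_def)
  have small: "x * \<eta> < m" if "x \<le> A" for x
  proof -
    have "x * \<eta> \<le> A * \<eta>" using that \<open>\<eta> > 0\<close> by (intro mult_right_mono) auto
    also have "\<dots> < m" using \<open>m > 0\<close> \<open>A > 0\<close> by (simp add: \<eta>_def)
    finally show ?thesis .
  qed
  have s1: "\<Lambda> * \<eta> < m" "(2 * L * \<Lambda> + 2) * \<eta> < m" "(\<Lambda> + 1) * \<eta> < m" "B * \<eta> < m"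
    by (rule small; use \<Lambda>_pos L\<Lambda> B_pos in \<open>simp add: A_def\<close>)+
  then have \<eta>: "\<Lambda> * \<eta> < 1" "(2 * L * \<Lambda> + 2) * \<eta> \<le> c" "(\<Lambda> + 1) * \<eta> < \<mu>" "(\<Lambda> + 1) * \<eta> < 3 * c * d"
      "\<Lambda> * \<eta> < 3 * c" "B * \<eta> < c"
    using c(1) by (auto simp: m_def)
  define G where "G = 5 * exp ((4 * L + 2) * T1) * 2"
  have "G \<ge> 0" by (simp add: G_def)
  define K where "K = B * ((2 + G) / (2 * c)) + G"
  have main: "\<bar>u \<sigma> - u' \<sigma>'\<bar> \<le> K * \<epsilon>"
    if Q: "Lipschitz_on_box M L Q" "\<And>x y. \<bar>x\<bar> \<le> M \<Longrightarrow> \<bar>y\<bar> \<le> M \<Longrightarrow> \<bar>Q x y - q x y\<bar> \<le> \<eta>"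
      and \<epsilon>: "0 \<le> \<epsilon>" "\<epsilon> \<le> \<eta>"
      and ret: "scaled_return Q M \<epsilon> u w e1 e2 \<sigma>" "scaled_return Q M \<epsilon> u' w' e1' e2' \<sigma>'"
      and le: "\<sigma> \<le> \<sigma>'"
    for Q \<epsilon> u w e1 e2 \<sigma> u' w' e1' e2' \<sigma>'
  proof -
    interpret a: perturbed_orbit q u0 w0 T0 T1 M L Q \<epsilon> u w e1 e2 \<sigma> \<eta>
      using model_orbit_axioms ret(1) Q \<epsilon> \<eta>(1)
      by (auto intro!: perturbed_orbit.intro perturbed_orbit_axioms.intro)
    interpret b: perturbed_orbit q u0 w0 T0 T1 M L Q \<epsilon> u' w' e1' e2' \<sigma>' \<eta>
      using model_orbit_axioms ret(2) Q \<epsilon> \<eta>(1)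
      by (auto intro!: perturbed_orbit.intro perturbed_orbit_axioms.intro)
    have \<sigma>: "\<sigma> \<in> {T0 - d..T0 + d}"
      by (rule a.return_time_near[OF c start fin away cross \<eta>(2-)])
    have \<sigma>': "\<sigma>' \<in> {T0 - d..T0 + d}"
      by (rule b.return_time_near[OF c start fin away cross \<eta>(2-)])
    have mins: "min \<sigma> T1 = \<sigma>" "min \<sigma>' T1 = \<sigma>'" using \<sigma> \<sigma>' c by auto
    have in_a: "\<bar>u s\<bar> \<le> M" "\<bar>w s\<bar> \<le> M" "\<bar>e1 s\<bar> \<le> \<epsilon>" "\<bar>e2 s\<bar> \<le> \<epsilon>" if "s \<in> {0..\<sigma>}" for s
      using a.in_box[of s] that mins by auto
    have in_b: "\<bar>u' s\<bar> \<le> M" "\<bar>w' s\<bar> \<le> M" "\<bar>e1' s\<bar> \<le> \<epsilon>" "\<bar>e2' s\<bar> \<le> \<epsilon>" if "s \<in> {0..\<sigma>'}" for s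
      using b.in_box[of s] that mins by auto
    have pts: "0 \<in> {0..\<sigma>}" "\<sigma> \<in> {0..\<sigma>}" "0 \<in> {0..\<sigma>'}" "\<sigma> \<in> {0..\<sigma>'}" "\<sigma>' \<in> {0..\<sigma>'}"
      using a.\<sigma>_pos le by auto
    have "\<bar>u \<sigma> - u' \<sigma>\<bar> \<le> 5 * exp ((4 * L + 2) * T1) * (2 * \<epsilon>) \<and>
          \<bar>w \<sigma> - w' \<sigma>\<bar> \<le> 5 * exp ((4 * L + 2) * T1) * (2 * \<epsilon>)"
    proof (rule gronwall_planar[where S = \<sigma> and ?u1.0 = u and ?u2.0 = u' and ?w1.0 = w and ?w2.0 = w'
          and ?p1.0 = "\<lambda>s. w s + e1 s" and ?p2.0 = "\<lambda>s. w' s + e1' s"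
          and ?r1.0 = "\<lambda>s. - Q (u s) (w s) + e2 s" and ?r2.0 = "\<lambda>s. - Q (u' s) (w' s) + e2' s"])
      fix s assume s: "s \<in> {0..\<sigma>}"
      then have s': "s \<in> {0..\<sigma>'}" using le by auto
      have sub: "{0..\<sigma>} \<subseteq> {0..\<sigma>'}" using le by auto
      show "(u has_real_derivative w s + e1 s) (at s within {0..\<sigma>})"
        by (rule a.u_deriv[OF s])
      show "(w has_real_derivative - Q (u s) (w s) + e2 s) (at s within {0..\<sigma>})"
        by (rule a.w_deriv[OF s])
      show "(u' has_real_derivative w' s + e1' s) (at s within {0..\<sigma>})"
        by (rule DERIV_subset[OF b.u_deriv[OF s'] sub])
      show "(w' has_real_derivative - Q (u' s) (w' s) + e2' s) (at s within {0..\<sigma>})"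
        by (rule DERIV_subset[OF b.w_deriv[OF s'] sub])
      have "1 * (\<bar>u s - u' s\<bar> + \<bar>w s - w' s\<bar>) \<le> L * (\<bar>u s - u' s\<bar> + \<bar>w s - w' s\<bar>)"
        using L_ge by (intro mult_right_mono) auto
      then have "\<bar>w s - w' s\<bar> \<le> L * (\<bar>u s - u' s\<bar> + \<bar>w s - w' s\<bar>)" by simp
      moreover have "\<bar>w s + e1 s - (w' s + e1' s)\<bar> \<le> \<bar>w s - w' s\<bar> + (\<bar>e1 s\<bar> + \<bar>e1' s\<bar>)"
        by linarith
      ultimately show "\<bar>w s + e1 s - (w' s + e1' s)\<bar> \<le> L * (\<bar>u s - u' s\<bar> + \<bar>w s - w' s\<bar>) + 2 * \<epsilon>"
        using in_a(3)[OF s] in_b(3)[OF s'] by simp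
      have "\<bar>Q (u s) (w s) - Q (u' s) (w' s)\<bar> \<le> L * (\<bar>u s - u' s\<bar> + \<bar>w s - w' s\<bar>)"
        by (rule Lipschitz_on_boxD[OF Q(1) in_a(1,2)[OF s] in_b(1,2)[OF s']])
      moreover have "\<bar>- Q (u s) (w s) + e2 s - (- Q (u' s) (w' s) + e2' s)\<bar>
          \<le> \<bar>Q (u s) (w s) - Q (u' s) (w' s)\<bar> + (\<bar>e2 s\<bar> + \<bar>e2' s\<bar>)"
        by linarith
      ultimately show "\<bar>- Q (u s) (w s) + e2 s - (- Q (u' s) (w' s) + e2' s)\<bar>
          \<le> L * (\<bar>u s - u' s\<bar> + \<bar>w s - w' s\<bar>) + 2 * \<epsilon>"
        using in_a(4)[OF s] in_b(4)[OF s'] by simp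
    next
      have "\<bar>w 0 - w' 0\<bar> \<le> 2 * \<epsilon>"
        using a.w_0 b.w_0 in_a(3)[OF pts(1)] in_b(3)[OF pts(3)] by linarith
      then show "\<bar>u 0 - u' 0\<bar> + \<bar>w 0 - w' 0\<bar> \<le> 2 * (2 * \<epsilon>)"
        using \<epsilon>(1) by (simp add: a.u_0 b.u_0)
    qed (use pts \<epsilon> L_ge \<sigma> c in auto)
    then have diff: "\<bar>u \<sigma> - u' \<sigma>\<bar> \<le> G * \<epsilon>" "\<bar>w \<sigma> - w' \<sigma>\<bar> \<le> G * \<epsilon>" by (auto simp: G_def)
    have "w' \<sigma>' - w' \<sigma> \<le> - (2 * c) * (\<sigma>' - \<sigma>)"
      using \<sigma> \<sigma>' le c mins \<eta>(2) fin by (intro b.descent) auto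
    moreover have "w \<sigma> = - e1 \<sigma>" "w' \<sigma>' = - e1' \<sigma>'"
      using a.w_\<sigma>[OF in_a(1,2)[OF pts(2)]] b.w_\<sigma>[OF in_b(1,2)[OF pts(5)]] by simp_all
    ultimately have "2 * c * (\<sigma>' - \<sigma>) \<le> (2 + G) * \<epsilon>"
      using diff(2) in_a(3)[OF pts(2)] in_b(3)[OF pts(5)] by (simp add: algebra_simps)
    then have "\<bar>\<sigma> - \<sigma>'\<bar> \<le> (2 + G) / (2 * c) * \<epsilon>"
      using c le by (simp add: field_simps)
    then have "B * \<bar>\<sigma> - \<sigma>'\<bar> \<le> B * ((2 + G) / (2 * c) * \<epsilon>)"
      using B_pos by (intro mult_left_mono) auto
    moreover have "\<bar>u' \<sigma> - u' \<sigma>'\<bar> \<le> B * \<bar>\<sigma> - \<sigma>'\<bar>"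
      using b.speed_bound(1)[of \<sigma> \<sigma>'] pts mins by simp
    ultimately have "\<bar>u \<sigma> - u' \<sigma>'\<bar> \<le> B * ((2 + G) / (2 * c) * \<epsilon>) + G * \<epsilon>"
      using diff(1) by linarith
    then show ?thesis by (simp add: K_def algebra_simps)
  qed
  show thesis
  proof (rule that[of \<eta> K])
    show "\<eta> > 0" by fact
    show "K \<ge> 0" using \<open>G \<ge> 0\<close> B_pos c by (simp add: K_def)
    fix Q \<epsilon> u w e1 e2 \<sigma> u' w' e1' e2' \<sigma>'
    assume *: "Lipschitz_on_box M L Q" "\<And>x y. \<bar>x\<bar> \<le> M \<Longrightarrow> \<bar>y\<bar> \<le> M \<Longrightarrow> \<bar>Q x y - q x y\<bar> \<le> \<eta>"
      "0 \<le> \<epsilon>" "\<epsilon> \<le> \<eta>" and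
      ret: "scaled_return Q M \<epsilon> u w e1 e2 \<sigma>" "scaled_return Q M \<epsilon> u' w' e1' e2' \<sigma>'"
    show "\<bar>u \<sigma> - u' \<sigma>'\<bar> \<le> K * \<epsilon>"
    proof (cases "\<sigma> \<le> \<sigma>'")
      case True
      show ?thesis by (rule main[OF * ret True])
    next
      case False
      then have "\<sigma>' \<le> \<sigma>" by simp
      from main[OF * ret(2,1) this] show ?thesis by (simp add: abs_minus_commute)
    qed
  qed
qed

section \<open>Rescaling the Lienard system\<close>

text \<open>
  Lipschitz continuity on the cube of radius \<open>R\<close> in the scaling parameter and both phase variables. Being
  closed under sums and products, it holds for polynomials.
\<close>

definition box_Lipschitz3 :: "real \<Rightarrow> (real \<Rightarrow> real \<Rightarrow> real \<Rightarrow> real) \<Rightarrow> bool" where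
  "box_Lipschitz3 R f \<longleftrightarrow> (\<exists>K\<ge>0. \<forall>h x y h' x' y'.
     \<bar>h\<bar> \<le> R \<longrightarrow> \<bar>x\<bar> \<le> R \<longrightarrow> \<bar>y\<bar> \<le> R \<longrightarrow> \<bar>h'\<bar> \<le> R \<longrightarrow> \<bar>x'\<bar> \<le> R \<longrightarrow> \<bar>y'\<bar> \<le> R \<longrightarrow>
     \<bar>f h x y - f h' x' y'\<bar> \<le> K * (\<bar>h - h'\<bar> + \<bar>x - x'\<bar> + \<bar>y - y'\<bar>))"

lemma box_Lipschitz3_const [intro]: "box_Lipschitz3 R (\<lambda>h x y. c)"
  unfolding box_Lipschitz3_def by (intro exI[of _ 0]) auto

lemma box_Lipschitz3_proj [intro]:
  "box_Lipschitz3 R (\<lambda>h x y. h)" "box_Lipschitz3 R (\<lambda>h x y. x)" "box_Lipschitz3 R (\<lambda>h x y. y)"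
  unfolding box_Lipschitz3_def by (intro exI[of _ 1]; auto)+

lemma box_Lipschitz3_add [intro]:
  assumes "box_Lipschitz3 R f" "box_Lipschitz3 R g"
  shows "box_Lipschitz3 R (\<lambda>h x y. f h x y + g h x y)"
proof -
  obtain K1 K2 where K: "K1 \<ge> 0" "K2 \<ge> 0"
    and f: "\<And>h x y h' x' y'. \<bar>h\<bar> \<le> R \<Longrightarrow> \<bar>x\<bar> \<le> R \<Longrightarrow> \<bar>y\<bar> \<le> R \<Longrightarrow> \<bar>h'\<bar> \<le> R \<Longrightarrow> \<bar>x'\<bar> \<le> R \<Longrightarrow> \<bar>y'\<bar> \<le> R \<Longrightarrow>
      \<bar>f h x y - f h' x' y'\<bar> \<le> K1 * (\<bar>h - h'\<bar> + \<bar>x - x'\<bar> + \<bar>y - y'\<bar>)"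
    and g: "\<And>h x y h' x' y'. \<bar>h\<bar> \<le> R \<Longrightarrow> \<bar>x\<bar> \<le> R \<Longrightarrow> \<bar>y\<bar> \<le> R \<Longrightarrow> \<bar>h'\<bar> \<le> R \<Longrightarrow> \<bar>x'\<bar> \<le> R \<Longrightarrow> \<bar>y'\<bar> \<le> R \<Longrightarrow>
      \<bar>g h x y - g h' x' y'\<bar> \<le> K2 * (\<bar>h - h'\<bar> + \<bar>x - x'\<bar> + \<bar>y - y'\<bar>)"
    using assms unfolding box_Lipschitz3_def by metis
  show ?thesis unfolding box_Lipschitz3_def
  proof (intro exI[of _ "K1 + K2"] conjI allI impI)
    fix h x y h' x' y'
    assume *: "\<bar>h\<bar> \<le> R" "\<bar>x\<bar> \<le> R" "\<bar>y\<bar> \<le> R" "\<bar>h'\<bar> \<le> R" "\<bar>x'\<bar> \<le> R" "\<bar>y'\<bar> \<le> R"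
    define d where "d = \<bar>h - h'\<bar> + \<bar>x - x'\<bar> + \<bar>y - y'\<bar>"
    have "\<bar>f h x y + g h x y - (f h' x' y' + g h' x' y')\<bar> \<le> K1 * d + K2 * d"
      using f[OF *] g[OF *] unfolding d_def by linarith
    then show "\<bar>f h x y + g h x y - (f h' x' y' + g h' x' y')\<bar> \<le> (K1 + K2) * (\<bar>h - h'\<bar> + \<bar>x - x'\<bar> + \<bar>y - y'\<bar>)"
      by (simp add: d_def distrib_right)
  qed (use K in auto)
qed

lemma box_Lipschitz3_mult [intro]:
  assumes "box_Lipschitz3 R f" "box_Lipschitz3 R g" "R \<ge> 0"
  shows "box_Lipschitz3 R (\<lambda>h x y. f h x y * g h x y)"
proof -
  obtain K1 K2 where K: "K1 \<ge> 0" "K2 \<ge> 0"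
    and f: "\<And>h x y h' x' y'. \<bar>h\<bar> \<le> R \<Longrightarrow> \<bar>x\<bar> \<le> R \<Longrightarrow> \<bar>y\<bar> \<le> R \<Longrightarrow> \<bar>h'\<bar> \<le> R \<Longrightarrow> \<bar>x'\<bar> \<le> R \<Longrightarrow> \<bar>y'\<bar> \<le> R \<Longrightarrow>
      \<bar>f h x y - f h' x' y'\<bar> \<le> K1 * (\<bar>h - h'\<bar> + \<bar>x - x'\<bar> + \<bar>y - y'\<bar>)"
    and g: "\<And>h x y h' x' y'. \<bar>h\<bar> \<le> R \<Longrightarrow> \<bar>x\<bar> \<le> R \<Longrightarrow> \<bar>y\<bar> \<le> R \<Longrightarrow> \<bar>h'\<bar> \<le> R \<Longrightarrow> \<bar>x'\<bar> \<le> R \<Longrightarrow> \<bar>y'\<bar> \<le> R \<Longrightarrow>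
      \<bar>g h x y - g h' x' y'\<bar> \<le> K2 * (\<bar>h - h'\<bar> + \<bar>x - x'\<bar> + \<bar>y - y'\<bar>)"
    using assms unfolding box_Lipschitz3_def by metis
  define A where "A = \<bar>f 0 0 0\<bar> + K1 * (3 * R)"
  define B where "B = \<bar>g 0 0 0\<bar> + K2 * (3 * R)"
  have fA: "\<bar>f h x y\<bar> \<le> A" if "\<bar>h\<bar> \<le> R" "\<bar>x\<bar> \<le> R" "\<bar>y\<bar> \<le> R" for h x y
  proof -
    have "\<bar>f h x y - f 0 0 0\<bar> \<le> K1 * (\<bar>h - 0\<bar> + \<bar>x - 0\<bar> + \<bar>y - 0\<bar>)"
      using that assms(3) by (intro f) auto
    also have "\<dots> \<le> K1 * (3 * R)" using that K by (intro mult_left_mono) auto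
    finally show ?thesis unfolding A_def by linarith
  qed
  have gB: "\<bar>g h x y\<bar> \<le> B" if "\<bar>h\<bar> \<le> R" "\<bar>x\<bar> \<le> R" "\<bar>y\<bar> \<le> R" for h x y
  proof -
    have "\<bar>g h x y - g 0 0 0\<bar> \<le> K2 * (\<bar>h - 0\<bar> + \<bar>x - 0\<bar> + \<bar>y - 0\<bar>)"
      using that assms(3) by (intro g) auto
    also have "\<dots> \<le> K2 * (3 * R)" using that K by (intro mult_left_mono) auto
    finally show ?thesis unfolding B_def by linarith
  qed
  have "A \<ge> 0" "B \<ge> 0" using K assms(3) by (auto simp: A_def B_def)
  show ?thesis unfolding box_Lipschitz3_def
  proof (intro exI[of _ "K1 * B + A * K2"] conjI allI impI)
    fix h x y h' x' y'
    assume *: "\<bar>h\<bar> \<le> R" "\<bar>x\<bar> \<le> R" "\<bar>y\<bar> \<le> R" "\<bar>h'\<bar> \<le> R" "\<bar>x'\<bar> \<le> R" "\<bar>y'\<bar> \<le> R"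
    define d where "d = \<bar>h - h'\<bar> + \<bar>x - x'\<bar> + \<bar>y - y'\<bar>"
    have "f h x y * g h x y - f h' x' y' * g h' x' y'
        = (f h x y - f h' x' y') * g h x y + f h' x' y' * (g h x y - g h' x' y')"
      by (simp add: algebra_simps)
    also have "\<bar>\<dots>\<bar> \<le> \<bar>f h x y - f h' x' y'\<bar> * \<bar>g h x y\<bar> + \<bar>f h' x' y'\<bar> * \<bar>g h x y - g h' x' y'\<bar>"
      by (intro order_trans[OF abs_triangle_ineq]) (simp add: abs_mult)
    also have "\<dots> \<le> (K1 * d) * B + A * (K2 * d)"
      using f[OF *] g[OF *] gB[OF *(1-3)] fA[OF *(4-6)] \<open>A \<ge> 0\<close> K
      by (intro add_mono mult_mono) (auto simp: d_def)
    also have "\<dots> = (K1 * B + A * K2) * d" by (simp add: algebra_simps)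
    finally show "\<bar>f h x y * g h x y - f h' x' y' * g h' x' y'\<bar>
        \<le> (K1 * B + A * K2) * (\<bar>h - h'\<bar> + \<bar>x - x'\<bar> + \<bar>y - y'\<bar>)"
      by (simp add: d_def)
  qed (use K \<open>A \<ge> 0\<close> \<open>B \<ge> 0\<close> in auto)
qed

lemma box_Lipschitz3_power:
  assumes "box_Lipschitz3 R f" "R \<ge> 0"
  shows "box_Lipschitz3 R (\<lambda>h x y. f h x y ^ i)"
  using assms by (induction i) auto

lemma box_Lipschitz3_sum:
  assumes "\<And>i. i \<in> I \<Longrightarrow> box_Lipschitz3 R (f i)"
  shows "box_Lipschitz3 R (\<lambda>h x y. \<Sum>i\<in>I. f i h x y)"
  using assms by (induction I rule: infinite_finite_induct) auto

text \<open>
  A polynomial \<open>f\<close> of order \<open>p\<close>, rescaled: this is \<open>f (h x) / h\<^sup>p\<close>, continued to \<open>h = 0\<close>.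
\<close>

definition graded_sum :: "nat \<Rightarrow> nat \<Rightarrow> (nat \<Rightarrow> real) \<Rightarrow> real \<Rightarrow> real \<Rightarrow> real" where
  "graded_sum p q c h x = (\<Sum>j=p..q. c j * h ^ (j - p) * x ^ j)"

text \<open>
  At \<open>h = 0\<close> only the lowest term survives, because \<open>0 ^ 0 = 1\<close>.
\<close>

lemma graded_sum_0:
  assumes "p \<le> q"
  shows "graded_sum p q c 0 x = c p * x ^ p"
proof -
  have "graded_sum p q c 0 x = (\<Sum>j\<in>{p}. c j * 0 ^ (j - p) * x ^ j)"
    unfolding graded_sum_def using assms by (intro sum.mono_neutral_right) auto
  then show ?thesis by simp
qed

lemma graded_sum_scale: "h ^ p * graded_sum p q c h x = (\<Sum>j=p..q. c j * (h * x) ^ j)"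
  unfolding graded_sum_def sum_distrib_left
proof (rule sum.cong)
  fix j assume "j \<in> {p..q}"
  then have "h ^ j = h ^ p * h ^ (j - p)" by (simp flip: power_add)
  then show "h ^ p * (c j * h ^ (j - p) * x ^ j) = c j * (h * x) ^ j"
    by (simp add: power_mult_distrib)
qed simp

definition scaled_force :: "nat \<Rightarrow> nat \<Rightarrow> (nat \<Rightarrow> real) \<Rightarrow> (nat \<Rightarrow> real) \<Rightarrow> real \<Rightarrow> real \<Rightarrow> real \<Rightarrow> real" where
  "scaled_force n m a b h u w =
     graded_sum (2 * n - 1) m a h u + w * graded_sum (n - 1) (m - 1) b h u"

lemma scaled_force_0:
  assumes "2 * n - 1 \<le> m" "n - 1 \<le> m - 1"
  shows "scaled_force n m a b 0 u w = a (2 * n - 1) * u ^ (2 * n - 1) + b (n - 1) * u ^ (n - 1) * w"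
  using assms by (simp add: scaled_force_def graded_sum_0)

lemma scaled_force_scale:
  assumes "n \<ge> 1"
  shows "h ^ (2 * n - 1) * scaled_force n m (\<lambda>j. a j \<delta>) (\<lambda>j. b j \<delta>) h u w =
    lienard_g n m a (h * u) \<delta> + h ^ n * w * lienard_f n m b (h * u) \<delta>"
proof -
  have "2 * n - 1 = n + (n - 1)" using assms by simp
  then have "h ^ (2 * n - 1) = h ^ n * h ^ (n - 1)" by (simp add: power_add)
  then have "h ^ (2 * n - 1) * (w * graded_sum (n - 1) (m - 1) (\<lambda>j. b j \<delta>) h u)
      = h ^ n * w * (h ^ (n - 1) * graded_sum (n - 1) (m - 1) (\<lambda>j. b j \<delta>) h u)"
    by simp
  then show ?thesis
    unfolding scaled_force_def distrib_left graded_sum_scale lienard_g_def lienard_f_def by simp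
qed

lemma scaled_force_Lipschitz:
  assumes "M \<ge> 1"
  obtains L where "L \<ge> 1"
    "\<And>h. 0 \<le> h \<Longrightarrow> h \<le> 1 \<Longrightarrow> Lipschitz_on_box M L (scaled_force n m a b h)"
    "\<And>h u w. 0 \<le> h \<Longrightarrow> h \<le> 1 \<Longrightarrow> \<bar>u\<bar> \<le> M \<Longrightarrow> \<bar>w\<bar> \<le> M \<Longrightarrow>
       \<bar>scaled_force n m a b h u w - scaled_force n m a b 0 u w\<bar> \<le> L * h"
proof -
  have "box_Lipschitz3 M (scaled_force n m a b)"
    unfolding scaled_force_def graded_sum_def using assms
    by (intro box_Lipschitz3_add box_Lipschitz3_mult box_Lipschitz3_sum box_Lipschitz3_power
        box_Lipschitz3_const box_Lipschitz3_proj) auto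
  then obtain K where K: "K \<ge> 0" "\<And>h x y h' x' y'.
     \<bar>h\<bar> \<le> M \<Longrightarrow> \<bar>x\<bar> \<le> M \<Longrightarrow> \<bar>y\<bar> \<le> M \<Longrightarrow> \<bar>h'\<bar> \<le> M \<Longrightarrow> \<bar>x'\<bar> \<le> M \<Longrightarrow> \<bar>y'\<bar> \<le> M \<Longrightarrow>
     \<bar>scaled_force n m a b h x y - scaled_force n m a b h' x' y'\<bar>
       \<le> K * (\<bar>h - h'\<bar> + \<bar>x - x'\<bar> + \<bar>y - y'\<bar>)"
    unfolding box_Lipschitz3_def by blast
  show thesis
  proof (rule that[of "K + 1"])
    fix h :: real assume h: "0 \<le> h" "h \<le> 1"
    show "Lipschitz_on_box M (K + 1) (scaled_force n m a b h)"
      unfolding Lipschitz_on_box_def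
    proof (intro allI impI)
      fix u w u' w' assume *: "\<bar>u\<bar> \<le> M" "\<bar>w\<bar> \<le> M" "\<bar>u'\<bar> \<le> M" "\<bar>w'\<bar> \<le> M"
      have "\<bar>scaled_force n m a b h u w - scaled_force n m a b h u' w'\<bar>
          \<le> K * (\<bar>h - h\<bar> + \<bar>u - u'\<bar> + \<bar>w - w'\<bar>)"
        using * h assms by (intro K) auto
      then show "\<bar>scaled_force n m a b h u w - scaled_force n m a b h u' w'\<bar>
          \<le> (K + 1) * (\<bar>u - u'\<bar> + \<bar>w - w'\<bar>)"
        by (simp add: algebra_simps)
    qed
    fix u w assume *: "\<bar>u\<bar> \<le> M" "\<bar>w\<bar> \<le> M"
    have "\<bar>scaled_force n m a b h u w - scaled_force n m a b 0 u w\<bar>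
        \<le> K * (\<bar>h - 0\<bar> + \<bar>u - u\<bar> + \<bar>w - w\<bar>)"
      using * h assms by (intro K) auto
    then show "\<bar>scaled_force n m a b h u w - scaled_force n m a b 0 u w\<bar> \<le> (K + 1) * h"
      using h by (simp add: algebra_simps)
  qed (use K in auto)
qed

text \<open>
  A box of radius \<open>M\<close> in scaled variables lies in the square of radius \<open>h M\<close>, where the Lipschitz constant
  is \<open>K (h M)\<^sup>m\<close>; one more factor \<open>h\<close> comes from \<open>x = h u\<close> and \<open>h\<^sup>n \<le> h\<close>. So dividing by
  \<open>h\<^sup>i\<close> leaves \<open>h\<^sup>m\<^sup>+\<^sup>1\<^sup>-\<^sup>i\<close>. It is used with \<open>i = n\<close> for \<open>u'\<close> and with \<open>i = 2n - 1\<close> for \<open>w'\<close>.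
\<close>

lemma flat_Lipschitz_rescale:
  assumes f: "flat_Lipschitz m K r f" and "K \<ge> 0" and "M \<ge> 1" and h: "0 < h" "h \<le> 1" "h * M \<le> r"
    and "n \<ge> 1" and "i + N \<le> m + 1"
  shows "Lipschitz_on_box M (K * M ^ m * h ^ N) (\<lambda>u w. f (h * u) (h ^ n * w) / h ^ i)"
    and "\<lbrakk>\<bar>u\<bar> \<le> M; \<bar>w\<bar> \<le> M\<rbrakk> \<Longrightarrow> \<bar>f (h * u) (h ^ n * w) / h ^ i\<bar> \<le> 2 * K * M ^ (m + 1) * h ^ N"
proof -
  have hn: "h ^ n \<le> h" using power_decreasing[of 1 n h] h \<open>n \<ge> 1\<close> by simp
  show Lip: "Lipschitz_on_box M (K * M ^ m * h ^ N) (\<lambda>u w. f (h * u) (h ^ n * w) / h ^ i)"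
    unfolding Lipschitz_on_box_def
  proof (intro allI impI)
    fix u w u' w' assume *: "\<bar>u\<bar> \<le> M" "\<bar>w\<bar> \<le> M" "\<bar>u'\<bar> \<le> M" "\<bar>w'\<bar> \<le> M"
    have hu: "\<bar>h * x\<bar> \<le> h * M" if "\<bar>x\<bar> \<le> M" for x
      using that h by (simp add: abs_mult)
    have hw: "\<bar>h ^ n * x\<bar> \<le> h * M" if "\<bar>x\<bar> \<le> M" for x
      using that h hn by (auto simp: abs_mult intro: mult_mono)
    have "\<bar>f (h * u) (h ^ n * w) - f (h * u') (h ^ n * w')\<bar>
        \<le> K * (h * M) ^ m * (\<bar>h * u - h * u'\<bar> + \<bar>h ^ n * w - h ^ n * w'\<bar>)"
      using hu hw * by (intro flat_LipschitzD[OF f h(3)]) auto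
    also have "\<dots> \<le> K * (h * M) ^ m * (h * \<bar>u - u'\<bar> + h * \<bar>w - w'\<bar>)"
    proof (intro mult_left_mono add_mono)
      show "\<bar>h * u - h * u'\<bar> \<le> h * \<bar>u - u'\<bar>" 
        using h by (simp add: abs_mult flip: right_diff_distrib)
      have "\<bar>h ^ n * w - h ^ n * w'\<bar> = h ^ n * \<bar>w - w'\<bar>"
        using h by (simp add: abs_mult flip: right_diff_distrib)
      also have "\<dots> \<le> h * \<bar>w - w'\<bar>" using hn by (rule mult_right_mono) simp
      finally show "\<bar>h ^ n * w - h ^ n * w'\<bar> \<le> h * \<bar>w - w'\<bar>" .
    qed (use h \<open>K \<ge> 0\<close> \<open>M \<ge> 1\<close> in auto)
    also have "\<dots> = K * M ^ m * (\<bar>u - u'\<bar> + \<bar>w - w'\<bar>) * h ^ (m + 1)"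
      by (simp add: power_mult_distrib algebra_simps)
    also have "\<dots> \<le> K * M ^ m * (\<bar>u - u'\<bar> + \<bar>w - w'\<bar>) * h ^ (i + N)"
      using h \<open>K \<ge> 0\<close> \<open>M \<ge> 1\<close> assms(8) by (intro mult_left_mono power_decreasing) auto
    finally have "\<bar>f (h * u) (h ^ n * w) - f (h * u') (h ^ n * w')\<bar> / h ^ i
        \<le> K * M ^ m * h ^ N * (\<bar>u - u'\<bar> + \<bar>w - w'\<bar>)"
      using h by (simp add: power_add field_simps)
    then show "\<bar>f (h * u) (h ^ n * w) / h ^ i - f (h * u') (h ^ n * w') / h ^ i\<bar>
        \<le> K * M ^ m * h ^ N * (\<bar>u - u'\<bar> + \<bar>w - w'\<bar>)"
      using h by (simp add: abs_divide flip: diff_divide_distrib)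
  qed
  assume uw: "\<bar>u\<bar> \<le> M" "\<bar>w\<bar> \<le> M"
  have "f 0 0 = 0" using f by (simp add: flat_Lipschitz_def)
  then have "\<bar>f (h * u) (h ^ n * w) / h ^ i\<bar> \<le> K * M ^ m * h ^ N * (\<bar>u\<bar> + \<bar>w\<bar>)"
    using Lipschitz_on_boxD[OF Lip uw, of 0 0] \<open>M \<ge> 1\<close> by simp
  also have "\<dots> \<le> K * M ^ m * h ^ N * (M + M)"
    using uw h \<open>K \<ge> 0\<close> \<open>M \<ge> 1\<close> by (intro mult_left_mono add_mono) auto
  finally show "\<bar>f (h * u) (h ^ n * w) / h ^ i\<bar> \<le> 2 * K * M ^ (m + 1) * h ^ N"
    by (simp add: mult_ac)
qed

text \<open>
  Where \<open>X\<close> has Lipschitz constant at most \<open>1/2\<close>, the equation \<open>y + X x y = 0\<close> has at most one solution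
  \<open>y\<close> for each \<open>x\<close>. So near the origin the graph of \<open>F\<close> is the whole zero set of \<open>x'\<close>, which
  turns the return condition into one on the velocity.
\<close>

lemma section_curve_iff:
  assumes X: "flat_Lipschitz m K r X" and "K \<ge> 0" "r > 0" "m \<ge> 1" and F: "section_curve X F"
  obtains r1 where "0 < r1" "r1 \<le> r" "r1 \<le> 1"
    "\<And>x y. \<bar>x\<bar> < r1 \<Longrightarrow> \<bar>y\<bar> < r1 \<Longrightarrow> y = F x \<longleftrightarrow> y + X x y = 0"
    "\<And>x. \<bar>x\<bar> < r1 \<Longrightarrow> F x + X x (F x) = 0"
    "\<And>x. \<bar>x\<bar> < r1 \<Longrightarrow> \<bar>F x\<bar> \<le> 2 * K * \<bar>x\<bar> ^ (m + 1)"
proof -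
  \<comment> \<open>\<open>1 / (2 K + 1)\<close> makes the Lipschitz constant \<open>K r2\<^sup>m \<le> K r2\<close> at most \<open>1/2\<close>.\<close>
  define r2 where "r2 = min (min r 1) (1 / (2 * K + 1))"
  have r2: "0 < r2" "r2 \<le> r" "r2 \<le> 1" using assms by (auto simp: r2_def)
  have half: "K * r2 ^ m \<le> 1 / 2"
  proof -
    have "K * r2 ^ m \<le> K * r2 ^ 1"
      using r2 assms by (intro mult_left_mono power_decreasing) auto
    also have "\<dots> \<le> K * (1 / (2 * K + 1))"
      using assms by (intro mult_left_mono) (auto simp: r2_def)
    also have "\<dots> \<le> 1 / 2" using assms by (simp add: field_simps)
    finally show ?thesis .
  qed
  have F0: "F 0 = 0" "isCont F 0" "\<forall>\<^sub>F x in nhds 0. F x + X x (F x) = 0"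
    using F by (auto simp: section_curve_def)
  have "\<forall>\<^sub>F x in nhds 0. \<bar>F x\<bar> < r2"
  proof -
    have "(F \<longlongrightarrow> F 0) (nhds 0)"
      using F0(2) by (simp add: continuous_at tendsto_at_iff_tendsto_nhds)
    then have "\<forall>\<^sub>F x in nhds 0. dist (F x) (F 0) < r2" using r2 by (intro tendstoD)
    then show ?thesis by (simp add: F0 dist_real_def)
  qed
  with F0(3) have "\<forall>\<^sub>F x in nhds 0. \<bar>F x\<bar> < r2 \<and> F x + X x (F x) = 0"
    by eventually_elim simp
  then obtain r3 where r3: "r3 > 0" "\<And>x. \<bar>x\<bar> < r3 \<Longrightarrow> \<bar>F x\<bar> < r2 \<and> F x + X x (F x) = 0"
    by (auto simp: eventually_nhds_metric dist_real_def)
  define r1 where "r1 = min r2 r3"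
  have lt: "\<bar>X x y - X x' y'\<bar> \<le> (\<bar>x - x'\<bar> + \<bar>y - y'\<bar>) / 2"
    if "\<bar>x\<bar> \<le> r2" "\<bar>y\<bar> \<le> r2" "\<bar>x'\<bar> \<le> r2" "\<bar>y'\<bar> \<le> r2" for x y x' y'
  proof -
    have "\<bar>X x y - X x' y'\<bar> \<le> K * r2 ^ m * (\<bar>x - x'\<bar> + \<bar>y - y'\<bar>)"
      using that by (intro flat_LipschitzD[OF X r2(2)]) auto
    also have "\<dots> \<le> 1 / 2 * (\<bar>x - x'\<bar> + \<bar>y - y'\<bar>)"
      using half by (intro mult_right_mono) auto
    finally show ?thesis by simp
  qed
  have X0: "X 0 0 = 0" using X by (simp add: flat_Lipschitz_def)
  show thesis
  proof (rule that[of r1])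
    show "0 < r1" "r1 \<le> r" "r1 \<le> 1" using r2 r3 by (auto simp: r1_def)
    show sol: "F x + X x (F x) = 0" if "\<bar>x\<bar> < r1" for x
      using r3 that by (simp add: r1_def)
    show "y = F x \<longleftrightarrow> y + X x y = 0" if "\<bar>x\<bar> < r1" "\<bar>y\<bar> < r1" for x y
    proof
      assume "y + X x y = 0"
      moreover have "F x + X x (F x) = 0" using sol that by simp
      moreover have "\<bar>X x y - X x (F x)\<bar> \<le> (\<bar>x - x\<bar> + \<bar>y - F x\<bar>) / 2"
        using that r3(2)[of x] by (intro lt) (auto simp: r1_def)
      ultimately show "y = F x" by (auto simp: abs_if split: if_splits)
    qed (use sol that in simp)
    show "\<bar>F x\<bar> \<le> 2 * K * \<bar>x\<bar> ^ (m + 1)" if x: "\<bar>x\<bar> < r1" for x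
    proof -
      have FX: "\<bar>F x\<bar> = \<bar>X x (F x) - X 0 0\<bar>" using sol[OF x] X0 by (simp add: abs_if)
      also have "\<dots> \<le> (\<bar>x - 0\<bar> + \<bar>F x - 0\<bar>) / 2"
        using x r3(2)[of x] r2 by (intro lt) (auto simp: r1_def)
      finally have le: "\<bar>F x\<bar> \<le> \<bar>x\<bar>" by simp
      have "\<bar>X x (F x) - X 0 0\<bar> \<le> K * \<bar>x\<bar> ^ m * (\<bar>x - 0\<bar> + \<bar>F x - 0\<bar>)"
        using x le r2 by (intro flat_LipschitzD[OF X]) (auto simp: r1_def)
      also have "\<dots> \<le> K * \<bar>x\<bar> ^ m * (\<bar>x\<bar> + \<bar>x\<bar>)"
        using le \<open>K \<ge> 0\<close> by (intro mult_left_mono) auto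
      finally show ?thesis using FX by (simp add: mult_ac)
    qed
  qed
qed

text \<open>
  The change of variables itself. With \<open>X = Y = 0\<close> it also covers the polynomial system, with the same
  constants.
\<close>

lemma first_return_rescale:
  fixes G H :: "real \<Rightarrow> real"
  assumes X: "flat_Lipschitz m K r X" and Y: "flat_Lipschitz m K r Y" and "K \<ge> 0" "r > 0"
    and F: "section_curve X F" and "n \<ge> 1" "N \<ge> 1" "N + 2 * n \<le> m + 2" "M \<ge> 1"
    and Q: "\<And>h u w. h ^ (2 * n - 1) * Q h u w = G (h * u) + h ^ n * w * H (h * u)"
  shows "\<exists>h1>0. \<forall>h p. 0 < h \<longrightarrow> h < h1 \<longrightarrow> first_return X (\<lambda>x y. - G x - y * H x + Y x y) F h p \<longrightarrow>
    (\<exists>u w e1 e2 \<sigma>. scaled_return (Q h) M (2 * K * M ^ (m + 1) * h ^ N) u w e1 e2 \<sigma> \<and> p = h * u \<sigma>)"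
proof -
  have "m \<ge> 1" using assms by linarith
  obtain r1 where r1: "0 < r1" "r1 \<le> r" "r1 \<le> 1"
    and iff: "\<And>x y. \<bar>x\<bar> < r1 \<Longrightarrow> \<bar>y\<bar> < r1 \<Longrightarrow> y = F x \<longleftrightarrow> y + X x y = 0"
    and sol: "\<And>x. \<bar>x\<bar> < r1 \<Longrightarrow> F x + X x (F x) = 0"
    and Fle: "\<And>x. \<bar>x\<bar> < r1 \<Longrightarrow> \<bar>F x\<bar> \<le> 2 * K * \<bar>x\<bar> ^ (m + 1)"
    using section_curve_iff[OF X \<open>K \<ge> 0\<close> \<open>r > 0\<close> \<open>m \<ge> 1\<close> F] by blast
  \<comment> \<open>The first bound keeps the scaled box inside the radius \<open>r1\<close>, the second puts the starting point
      \<open>(1, F h / h\<^sup>n)\<close> into the box.\<close>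
  define h1 where "h1 = min (r1 / M) (1 / (2 * K + 1))"
  have "h1 > 0" using r1 assms by (simp add: h1_def)
  moreover have "\<exists>u w e1 e2 \<sigma>. scaled_return (Q h) M (2 * K * M ^ (m + 1) * h ^ N) u w e1 e2 \<sigma> \<and> p = h * u \<sigma>"
    if h: "0 < h" "h < h1" and ret: "first_return X (\<lambda>x y. - G x - y * H x + Y x y) F h p" for h p
  proof -
    have "h < r1 / M" using h by (simp add: h1_def)
    then have hM: "h * M < r1" using assms by (simp add: field_simps)
    have "h * 1 \<le> h * M" using h assms by (intro mult_left_mono) auto
    then have hr: "h < r1" "h \<le> 1" "h * M \<le> r" using hM r1 by auto
    have hn: "h ^ n \<le> h" using power_decreasing[of 1 n h] h hr \<open>n \<ge> 1\<close> by simp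
    have hK: "2 * K * h \<le> 1"
    proof -
      have "2 * K * h \<le> 2 * K * (1 / (2 * K + 1))"
        using h assms by (intro mult_left_mono) (auto simp: h1_def)
      also have "\<dots> \<le> 1" using assms by (simp add: field_simps)
      finally show ?thesis .
    qed
    from ret obtain x y \<tau> where "\<tau> > 0" and sol': "solves_on X (\<lambda>x y. - G x - y * H x + Y x y) x y \<tau>"
      and x0: "x 0 = h" "y 0 = F h" and end': "y \<tau> = F (x \<tau>)" "h * x \<tau> > 0"
      and no: "\<And>t. 0 < t \<Longrightarrow> t < \<tau> \<Longrightarrow> \<not> (y t = F (x t) \<and> h * x t > 0)" and p: "p = x \<tau>"
      unfolding first_return_def by blast
    \<comment> \<open>Scaled time is \<open>s = l t\<close>.\<close>
    define l where "l = h ^ (n - 1)"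
    have "l > 0" using h by (simp add: l_def)
    have hl: "h ^ n = h * l" "h ^ (2 * n - 1) = h ^ n * l"
    proof -
      show "h ^ n = h * l" using \<open>n \<ge> 1\<close> unfolding l_def by (cases n) auto
      have "2 * n - 1 = n + (n - 1)" using \<open>n \<ge> 1\<close> by simp
      then show "h ^ (2 * n - 1) = h ^ n * l" by (simp add: l_def power_add)
    qed
    define \<sigma> where "\<sigma> = l * \<tau>"
    define u where "u s = x (s / l) / h" for s
    define w where "w s = y (s / l) / h ^ n" for s
    define e1 where "e1 s = X (h * u s) (h ^ n * w s) / h ^ n" for s
    define e2 where "e2 s = Y (h * u s) (h ^ n * w s) / h ^ (2 * n - 1)" for s
    have hu: "h * u s = x (s / l)" and hw: "h ^ n * w s = y (s / l)" for s
      using h by (simp_all add: u_def w_def)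
    have sum1: "w s + e1 s = (y (s / l) + X (x (s / l)) (y (s / l))) / h ^ n" for s
      unfolding e1_def hu hw by (simp add: w_def add_divide_distrib)
    have sum2: "- Q h (u s) (w s) + e2 s
      = (- G (x (s / l)) - y (s / l) * H (x (s / l)) + Y (x (s / l)) (y (s / l))) / h ^ (2 * n - 1)" for s
    proof -
      have "Q h (u s) (w s) = (G (x (s / l)) + y (s / l) * H (x (s / l))) / h ^ (2 * n - 1)"
        using Q[of h "u s" "w s"] h unfolding hu hw by (simp add: field_simps)
      then show ?thesis
        unfolding e2_def hu hw by (simp add: add_divide_distrib diff_divide_distrib)
    qed
    have small: "\<bar>x (s / l)\<bar> < r1" "\<bar>y (s / l)\<bar> < r1" if "\<bar>u s\<bar> \<le> M" "\<bar>w s\<bar> \<le> M" for s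
    proof -
      have "\<bar>h * u s\<bar> \<le> h * M" using that h by (simp add: abs_mult)
      then show "\<bar>x (s / l)\<bar> < r1" using hM by (simp add: hu)
      have "\<bar>h ^ n * w s\<bar> \<le> h * M"
        using that h hn by (auto simp: abs_mult intro: mult_mono)
      then show "\<bar>y (s / l)\<bar> < r1" using hM by (simp add: hw)
    qed
    have \<tau>: "\<sigma> / l = \<tau>" using \<open>l > 0\<close> by (simp add: \<sigma>_def)
    have img: "(\<lambda>s. s / l) ` {0..\<sigma>} \<subseteq> {0..\<tau>}"
      using \<open>l > 0\<close> by (auto simp: \<sigma>_def field_simps)
    have div: "((\<lambda>s. s / l) has_real_derivative 1 / l) (at s within A)" for s A
      using \<open>l > 0\<close> by (auto intro!: derivative_eq_intros)
    have dx: "((\<lambda>s. x (s / l)) has_real_derivative (y (s / l) + X (x (s / l)) (y (s / l))) * (1 / l))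
          (at s within {0..\<sigma>})" (is ?dx)
      and dy: "((\<lambda>s. y (s / l)) has_real_derivative
          (- G (x (s / l)) - y (s / l) * H (x (s / l)) + Y (x (s / l)) (y (s / l))) * (1 / l))
          (at s within {0..\<sigma>})" (is ?dy) if s: "s \<in> {0..\<sigma>}" for s
    proof -
      have "s / l \<in> {0..\<tau>}" using img s by blast
      then have "(x has_real_derivative y (s / l) + X (x (s / l)) (y (s / l))) (at (s / l) within (\<lambda>s. s / l) ` {0..\<sigma>})"
        "(y has_real_derivative - G (x (s / l)) - y (s / l) * H (x (s / l)) + Y (x (s / l)) (y (s / l)))
          (at (s / l) within (\<lambda>s. s / l) ` {0..\<sigma>})"
        using sol' unfolding solves_on_def by (auto intro: DERIV_subset[OF _ img])
      from DERIV_image_chain[OF this(1) div] DERIV_image_chain[OF this(2) div]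
      show ?dx ?dy by (simp_all add: o_def)
    qed
    note bX = flat_Lipschitz_rescale[OF X \<open>K \<ge> 0\<close> \<open>M \<ge> 1\<close> h(1) hr(2,3) \<open>n \<ge> 1\<close>, where i = n and N = N]
    note bY = flat_Lipschitz_rescale[OF Y \<open>K \<ge> 0\<close> \<open>M \<ge> 1\<close> h(1) hr(2,3) \<open>n \<ge> 1\<close>, where i = "2 * n - 1" and N = N]
    have iN: "n + N \<le> m + 1" "2 * n - 1 + N \<le> m + 1" using assms by auto
    have "scaled_return (Q h) M (2 * K * M ^ (m + 1) * h ^ N) u w e1 e2 \<sigma>"
    proof
      show "\<sigma> > 0" using \<open>l > 0\<close> \<open>\<tau> > 0\<close> by (simp add: \<sigma>_def)
      show "u 0 = 1" using h by (simp add: u_def x0)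
      show "w 0 + e1 0 = 0" unfolding sum1 using sol[of h] h hr by (simp add: x0)
      have "\<bar>F h\<bar> \<le> 2 * K * \<bar>h\<bar> ^ (m + 1)" using h hr by (intro Fle) auto
      also have "\<dots> \<le> 2 * K * (h * h ^ n)"
      proof (intro mult_left_mono)
        have "h ^ (m + 1) \<le> h ^ (Suc n)"
          using h hr assms by (intro power_decreasing) auto
        then show "\<bar>h\<bar> ^ (m + 1) \<le> h * h ^ n" using h by simp
      qed (use \<open>K \<ge> 0\<close> in simp)
      also have "\<dots> = 2 * K * h * h ^ n" by simp
      also have "\<dots> \<le> 1 * h ^ n" using hK h by (intro mult_right_mono) auto
      finally have "\<bar>F h\<bar> / h ^ n \<le> 1" using h by simp
      moreover have "\<bar>w 0\<bar> = \<bar>F h\<bar> / h ^ n" using h by (simp add: w_def x0 abs_divide)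
      ultimately show "\<bar>w 0\<bar> \<le> M" using \<open>M \<ge> 1\<close> by linarith
      show "(u has_real_derivative w s + e1 s) (at s within {0..\<sigma>})" if "s \<in> {0..\<sigma>}" for s
        unfolding sum1 unfolding u_def using DERIV_cdivide[OF dx[OF that], of h]
        by (simp add: hl mult_ac)
      show "(w has_real_derivative - Q h (u s) (w s) + e2 s) (at s within {0..\<sigma>})" if "s \<in> {0..\<sigma>}" for s
        unfolding sum2 unfolding w_def using DERIV_cdivide[OF dy[OF that], of "h ^ n"]
        unfolding hl by (simp add: mult_ac)
      show "\<bar>e1 s\<bar> \<le> 2 * K * M ^ (m + 1) * h ^ N \<and> \<bar>e2 s\<bar> \<le> 2 * K * M ^ (m + 1) * h ^ N"
        if "\<bar>u s\<bar> \<le> M" "\<bar>w s\<bar> \<le> M" for s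
        unfolding e1_def e2_def using bX(2)[OF iN(1) that] bY(2)[OF iN(2) that] by simp
      show "\<bar>e1 s - e1 t\<bar> \<le> 2 * K * M ^ (m + 1) * h ^ N * (\<bar>u s - u t\<bar> + \<bar>w s - w t\<bar>)"
        if "\<bar>u s\<bar> \<le> M" "\<bar>w s\<bar> \<le> M" "\<bar>u t\<bar> \<le> M" "\<bar>w t\<bar> \<le> M" for s t
      proof -
        have "\<bar>e1 s - e1 t\<bar> \<le> K * M ^ m * h ^ N * (\<bar>u s - u t\<bar> + \<bar>w s - w t\<bar>)"
          unfolding e1_def by (rule Lipschitz_on_boxD[OF bX(1)[OF iN(1)] that])
        also have "\<dots> \<le> (2 * M) * (K * M ^ m * h ^ N * (\<bar>u s - u t\<bar> + \<bar>w s - w t\<bar>))"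
        proof -
          have "0 \<le> K * M ^ m * h ^ N * (\<bar>u s - u t\<bar> + \<bar>w s - w t\<bar>)"
            using h \<open>K \<ge> 0\<close> \<open>M \<ge> 1\<close> by simp
          moreover have "1 \<le> 2 * M" using \<open>M \<ge> 1\<close> by simp
          ultimately show ?thesis using mult_right_mono[of 1 "2 * M"] by fastforce
        qed
        also have "\<dots> = 2 * K * M ^ (m + 1) * h ^ N * (\<bar>u s - u t\<bar> + \<bar>w s - w t\<bar>)"
          by (simp add: algebra_simps)
        finally show ?thesis .
      qed
      show "u \<sigma> > 0" using end'(2) h by (simp add: u_def \<tau> zero_less_mult_iff)
      show "w \<sigma> + e1 \<sigma> = 0" if "\<bar>u \<sigma>\<bar> \<le> M" "\<bar>w \<sigma>\<bar> \<le> M"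
        unfolding sum1 using small[OF that] sol[of "x \<tau>"] end'(1) by (simp add: \<tau>)
      show "w s + e1 s \<noteq> 0" if "0 < s" "s < \<sigma>" "\<bar>u s\<bar> \<le> M" "\<bar>w s\<bar> \<le> M" "u s > 0" for s
      proof
        assume "w s + e1 s = 0"
        then have "y (s / l) = F (x (s / l))"
          using iff[OF small[OF that(3,4)]] h by (simp add: sum1)
        moreover have "0 < s / l" "s / l < \<tau>"
          using that \<open>l > 0\<close> by (auto simp: \<sigma>_def field_simps)
        moreover have "h * x (s / l) > 0" using that h by (simp add: u_def zero_less_divide_iff)
        ultimately show False using no by blast
      qed
    qed
    moreover have "p = h * u \<sigma>" using p by (simp add: hu \<tau>)
    ultimately show ?thesis by blast
  qed
  ultimately show ?thesis by blast
qed

section \<open>Agreement of the return maps\<close>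

text \<open>
  Both rescaled orbits are orbits of the same field \<open>Q h\<close> up to errors \<open>C h\<^sup>N\<close>, so their return points
  differ by \<open>O(h\<^sup>N)\<close>; scaling back by \<open>x = h u\<close> gains the last factor \<open>h\<close>.
\<close>

lemma return_maps_agree:
  fixes n m N :: nat and a b :: "nat \<Rightarrow> 'd \<Rightarrow> real" and \<delta> :: 'd
  assumes n: "n \<ge> 1" and m: "2 * n - 1 \<le> m" "n - 1 \<le> m - 1" and N: "N \<ge> 1" "N + 2 * n \<le> m + 2"
    and a_pos: "a (2 * n - 1) \<delta> > 0"
    and focus: "(b (n - 1) \<delta>)\<^sup>2 - 4 * real n * a (2 * n - 1) \<delta> < 0"
    and X: "flat_Lipschitz m K r X" and Y: "flat_Lipschitz m K r Y" and Kr: "K \<ge> 0" "r > 0"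
    and P: "poincare_return_map X (\<lambda>x y. - lienard_g n m a x \<delta> - y * lienard_f n m b x \<delta> + Y x y) P"
    and P': "poincare_return_map (\<lambda>x y. 0) (\<lambda>x y. - lienard_g n m a x \<delta> - y * lienard_f n m b x \<delta>) P'"
  shows "(\<lambda>h. P h - P' h) \<in> O[at_right 0](\<lambda>h. h ^ (N + 1))"
proof -
  define Q where "Q = scaled_force n m (\<lambda>j. a j \<delta>) (\<lambda>j. b j \<delta>)"
  have Q0: "Q 0 u w = a (2 * n - 1) \<delta> * u ^ (2 * n - 1) + b (n - 1) \<delta> * u ^ (n - 1) * w" for u w
    unfolding Q_def using scaled_force_0[OF m] .
  have focus': "(b (n - 1) \<delta>)\<^sup>2 < 4 * real n * a (2 * n - 1) \<delta>" using focus by simp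
  obtain u0 w0 T0 T1 where T: "0 < T0" "T0 < T1"
    and u0: "\<And>t. t \<in> {0..T1} \<Longrightarrow> (u0 has_real_derivative w0 t) (at t within {0..T1})"
    and w0: "\<And>t. t \<in> {0..T1} \<Longrightarrow> (w0 has_real_derivative - Q 0 (u0 t) (w0 t)) (at t within {0..T1})"
    and ends: "u0 0 = 1" "w0 0 = 0" "w0 T0 = 0" "u0 T0 > 0"
    and avoid: "\<And>t. 0 < t \<Longrightarrow> t < T0 \<Longrightarrow> w0 t \<noteq> 0 \<or> u0 t < 0"
  proof (rule model_system_returns[OF a_pos focus' n, folded Q0])
    fix u w T0 T1
    assume "0 < T0" "T0 < T1"
      "\<And>t. t \<in> {0..T1} \<Longrightarrow> (u has_real_derivative w t) (at t within {0..T1})"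
      "\<And>t. t \<in> {0..T1} \<Longrightarrow> (w has_real_derivative - Q 0 (u t) (w t)) (at t within {0..T1})"
      "u 0 = 1" "w 0 = 0" "w T0 = 0" "u T0 > 0" "\<And>t. 0 < t \<Longrightarrow> t < T0 \<Longrightarrow> w t \<noteq> 0 \<or> u t < 0"
    then show thesis by (rule that)
  qed
  obtain Mu where Mu: "\<And>t. t \<in> {0..T1} \<Longrightarrow> norm (u0 t) \<le> Mu"
    using continuous_on_compact_bound[OF compact_Icc DERIV_continuous_on[OF u0]] by metis
  obtain Mw where Mw: "\<And>t. t \<in> {0..T1} \<Longrightarrow> norm (w0 t) \<le> Mw"
    using continuous_on_compact_bound[OF compact_Icc DERIV_continuous_on[OF w0]] by metis
  define M where "M = max Mu Mw + 1"
  have "M \<ge> 1" using Mu[of 0] T ends by (simp add: M_def)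
  obtain L where L: "L \<ge> 1"
    and Lip: "\<And>h. 0 \<le> h \<Longrightarrow> h \<le> 1 \<Longrightarrow> Lipschitz_on_box M L (Q h)"
    and near: "\<And>h u w. 0 \<le> h \<Longrightarrow> h \<le> 1 \<Longrightarrow> \<bar>u\<bar> \<le> M \<Longrightarrow> \<bar>w\<bar> \<le> M \<Longrightarrow> \<bar>Q h u w - Q 0 u w\<bar> \<le> L * h"
    unfolding Q_def using scaled_force_Lipschitz[OF \<open>M \<ge> 1\<close>] by metis
  interpret model_orbit "Q 0" u0 w0 T0 T1 M L
  proof
    show "\<bar>u0 t\<bar> \<le> M - 1" "\<bar>w0 t\<bar> \<le> M - 1" if "t \<in> {0..T1}" for t
      using Mu[OF that] Mw[OF that] by (auto simp: M_def)
    show "Lipschitz_on_box M L (Q 0)" by (rule Lip) auto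
    show "Q 0 x 0 > 0" if "x > 0" for x using that a_pos by (simp add: Q0)
  qed (fact T u0 w0 ends avoid L)+
  obtain \<eta> K' where \<eta>: "\<eta> > 0" "K' \<ge> 0"
    and close: "\<And>Q' \<epsilon> u w e1 e2 \<sigma> u' w' e1' e2' \<sigma>'.
       Lipschitz_on_box M L Q' \<Longrightarrow> (\<And>x y. \<bar>x\<bar> \<le> M \<Longrightarrow> \<bar>y\<bar> \<le> M \<Longrightarrow> \<bar>Q' x y - Q 0 x y\<bar> \<le> \<eta>) \<Longrightarrow>
       0 \<le> \<epsilon> \<Longrightarrow> \<epsilon> \<le> \<eta> \<Longrightarrow>
       scaled_return Q' M \<epsilon> u w e1 e2 \<sigma> \<Longrightarrow> scaled_return Q' M \<epsilon> u' w' e1' e2' \<sigma>' \<Longrightarrow>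
       \<bar>u \<sigma> - u' \<sigma>'\<bar> \<le> K' * \<epsilon>"
    using returns_close by blast
  define C where "C = 2 * K * M ^ (m + 1)"
  have "C \<ge> 0" using Kr \<open>M \<ge> 1\<close> by (simp add: C_def)
  note scale = scaled_force_scale[OF n, of _ m a \<delta> b, folded Q_def]
  obtain F where F: "section_curve X F" and FP: "\<forall>\<^sub>F h in at 0. first_return X
      (\<lambda>x y. - lienard_g n m a x \<delta> - y * lienard_f n m b x \<delta> + Y x y) F h (P h)"
    using P unfolding poincare_return_map_def by blast
  obtain F' where F': "section_curve (\<lambda>x y. 0) F'" and FP': "\<forall>\<^sub>F h in at 0. first_return (\<lambda>x y. 0)
      (\<lambda>x y. - lienard_g n m a x \<delta> - y * lienard_f n m b x \<delta>) F' h (P' h)"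
    using P' unfolding poincare_return_map_def by blast
  obtain h1 where h1: "h1 > 0" "\<And>h p. 0 < h \<Longrightarrow> h < h1 \<Longrightarrow>
      first_return X (\<lambda>x y. - lienard_g n m a x \<delta> - y * lienard_f n m b x \<delta> + Y x y) F h p \<Longrightarrow>
      \<exists>u w e1 e2 \<sigma>. scaled_return (Q h) M (C * h ^ N) u w e1 e2 \<sigma> \<and> p = h * u \<sigma>"
    using first_return_rescale[OF X Y Kr F n N \<open>M \<ge> 1\<close> scale, folded C_def] by blast
  note zero = flat_Lipschitz_zero[OF Kr(1), of m r]
  obtain h2 where h2: "h2 > 0" "\<And>h p. 0 < h \<Longrightarrow> h < h2 \<Longrightarrow>
      first_return (\<lambda>x y. 0) (\<lambda>x y. - lienard_g n m a x \<delta> - y * lienard_f n m b x \<delta>) F' h p \<Longrightarrow>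
      \<exists>u w e1 e2 \<sigma>. scaled_return (Q h) M (C * h ^ N) u w e1 e2 \<sigma> \<and> p = h * u \<sigma>"
    using first_return_rescale[OF zero zero Kr F' n N \<open>M \<ge> 1\<close> scale, folded C_def, unfolded add_0_right]
    by blast
  \<comment> \<open>Small enough for \<open>|Q h - Q 0| \<le> L h\<close> and for the errors \<open>C h\<^sup>N \<le> C h\<close> to stay below \<open>\<eta>\<close>.\<close>
  define h0 where "h0 = min (min h1 h2) (min 1 (\<eta> / (L + C)))"
  have "h0 > 0" using h1 h2 \<eta> L \<open>C \<ge> 0\<close> by (simp add: h0_def)
  have "\<forall>\<^sub>F h in at_right 0. 0 < h \<and> h < h0"
    using \<open>h0 > 0\<close> by (intro eventually_at_rightI[of 0 h0]) auto
  moreover have "\<forall>\<^sub>F h in at_right 0. first_return X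
      (\<lambda>x y. - lienard_g n m a x \<delta> - y * lienard_f n m b x \<delta> + Y x y) F h (P h)"
    using FP by (simp add: eventually_at_split)
  moreover have "\<forall>\<^sub>F h in at_right 0. first_return (\<lambda>x y. 0)
      (\<lambda>x y. - lienard_g n m a x \<delta> - y * lienard_f n m b x \<delta>) F' h (P' h)"
    using FP' by (simp add: eventually_at_split)
  ultimately have "\<forall>\<^sub>F h in at_right 0. norm (P h - P' h) \<le> K' * C * norm (h ^ (N + 1))"
  proof eventually_elim
    case (elim h)
    then have h: "0 < h" "h < h1" "h < h2" "h \<le> 1" "h < \<eta> / (L + C)" by (auto simp: h0_def)
    obtain u w e1 e2 \<sigma> where u: "scaled_return (Q h) M (C * h ^ N) u w e1 e2 \<sigma>" "P h = h * u \<sigma>"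
      using h1(2)[OF h(1,2)] elim by blast
    obtain u' w' e1' e2' \<sigma>' where u': "scaled_return (Q h) M (C * h ^ N) u' w' e1' e2' \<sigma>'" "P' h = h * u' \<sigma>'"
      using h2(2)[OF h(1,3)] elim by blast
    have "(L + C) * h \<le> \<eta>" using h L \<open>C \<ge> 0\<close> by (simp add: field_simps)
    moreover have "C * h \<ge> 0" "L * h \<ge> 0" using h L \<open>C \<ge> 0\<close> by auto
    ultimately have le: "L * h \<le> \<eta>" "C * h \<le> \<eta>" by (simp_all add: distrib_right)
    have "C * h ^ N \<le> C * h ^ 1"
      using h N \<open>C \<ge> 0\<close> by (intro mult_left_mono power_decreasing) auto
    then have "C * h ^ N \<le> \<eta>" using le by simp
    have "\<bar>u \<sigma> - u' \<sigma>'\<bar> \<le> K' * (C * h ^ N)"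
    proof (rule close[OF _ _ _ \<open>C * h ^ N \<le> \<eta>\<close> u(1) u'(1)])
      show "Lipschitz_on_box M L (Q h)" using h by (intro Lip) auto
      show "\<bar>Q h x y - Q 0 x y\<bar> \<le> \<eta>" if "\<bar>x\<bar> \<le> M" "\<bar>y\<bar> \<le> M" for x y
        using near[of h x y] that h le by linarith
      show "0 \<le> C * h ^ N" using h \<open>C \<ge> 0\<close> by simp
    qed
    then have "h * \<bar>u \<sigma> - u' \<sigma>'\<bar> \<le> h * (K' * (C * h ^ N))"
      using h by (intro mult_left_mono) auto
    then show ?case using h unfolding u(2) u'(2) by (simp add: abs_mult mult_ac flip: right_diff_distrib)
  qed
  then show ?thesis by (rule bigoI)
qed

theorem theorem1p10:
  fixes n m k :: nat
    and D :: "'d::euclidean_space set"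
    and a b :: "nat \<Rightarrow> 'd \<Rightarrow> real"
    and X Y :: "real \<Rightarrow> real \<Rightarrow> 'd \<Rightarrow> real"
    and P Pm :: "real \<Rightarrow> 'd \<Rightarrow> real"
    and v vbar :: "nat \<Rightarrow> 'd \<Rightarrow> real"
  assumes "n \<ge> 2" and "m > 2 * n - 1"
    and "compact D"
    and "\<And>\<delta>. \<delta> \<in> D \<Longrightarrow> a (2 * n - 1) \<delta> > 0"
    and "\<And>\<delta>. \<delta> \<in> D \<Longrightarrow> (b (n - 1) \<delta>)\<^sup>2 - 4 * real n * a (2 * n - 1) \<delta> < 0"
    and "\<And>\<delta>. \<delta> \<in> D \<Longrightarrow> real_analytic2_at_origin (\<lambda>x y. X x y \<delta>)"
    and "\<And>\<delta>. \<delta> \<in> D \<Longrightarrow> real_analytic2_at_origin (\<lambda>x y. Y x y \<delta>)"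
    and "\<And>\<delta>. \<delta> \<in> D \<Longrightarrow>
           (\<lambda>z. X (fst z) (snd z) \<delta>) \<in> O[nhds (0, 0)](\<lambda>z. norm z ^ (m + 1))"
    and "\<And>\<delta>. \<delta> \<in> D \<Longrightarrow>
           (\<lambda>z. Y (fst z) (snd z) \<delta>) \<in> O[nhds (0, 0)](\<lambda>z. norm z ^ (m + 1))"
    and "\<And>\<delta>. \<delta> \<in> D \<Longrightarrow>
           poincare_return_map (\<lambda>x y. X x y \<delta>)
             (\<lambda>x y. - lienard_g n m a x \<delta> - y * lienard_f n m b x \<delta> + Y x y \<delta>)
             (\<lambda>x0. P x0 \<delta>)"
    and "\<And>\<delta>. \<delta> \<in> D \<Longrightarrow>
           poincare_return_map (\<lambda>x y. 0)
             (\<lambda>x y. - lienard_g n m a x \<delta> - y * lienard_f n m b x \<delta>)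
             (\<lambda>x0. Pm x0 \<delta>)"
    and "\<And>\<delta>. \<delta> \<in> D \<Longrightarrow> return_expansion (\<lambda>x0. P x0 \<delta>) (\<lambda>j. v j \<delta>)"
    and "\<And>\<delta>. \<delta> \<in> D \<Longrightarrow> return_expansion (\<lambda>x0. Pm x0 \<delta>) (\<lambda>j. vbar j \<delta>)"
    and "k \<ge> 1" and "m \<ge> (k + 2) * n - 2"
  shows "\<forall>\<delta>\<in>D. \<forall>j. 1 \<le> j \<and> j \<le> k * n \<longrightarrow> v j \<delta> = vbar j \<delta>"
proof (intro ballI allI impI)
  fix \<delta> j assume \<delta>: "\<delta> \<in> D" and j: "1 \<le> j \<and> j \<le> k * n"
  have bigX: "(\<lambda>z. X (fst z) (snd z) \<delta>) \<in> O[nhds (0, 0)](\<lambda>z. norm z ^ Suc m)"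
    and bigY: "(\<lambda>z. Y (fst z) (snd z) \<delta>) \<in> O[nhds (0, 0)](\<lambda>z. norm z ^ Suc m)"
    using assms(8,9)[OF \<delta>] by simp_all
  obtain K1 r1 where 1: "K1 \<ge> 0" "r1 > 0" "flat_Lipschitz m K1 r1 (\<lambda>x y. X x y \<delta>)"
    using analytic_flat_Lipschitz[OF assms(6)[OF \<delta>] bigX] .
  obtain K2 r2 where 2: "K2 \<ge> 0" "r2 > 0" "flat_Lipschitz m K2 r2 (\<lambda>x y. Y x y \<delta>)"
    using analytic_flat_Lipschitz[OF assms(7)[OF \<delta>] bigY] .
  have N: "k * n \<ge> 1" "k * n + 2 * n \<le> m + 2"
    using assms(1,14,15) by (auto simp: algebra_simps)
  have "(\<lambda>h. P h \<delta> - Pm h \<delta>) \<in> O[at_right 0](\<lambda>h. h ^ (k * n + 1))"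
  proof (rule return_maps_agree[OF _ _ _ N])
    show "flat_Lipschitz m (max K1 K2) (min r1 r2) (\<lambda>x y. X x y \<delta>)"
      "flat_Lipschitz m (max K1 K2) (min r1 r2) (\<lambda>x y. Y x y \<delta>)"
      by (rule flat_Lipschitz_mono[OF 1(3)] flat_Lipschitz_mono[OF 2(3)]; simp)+
    show "poincare_return_map (\<lambda>x y. X x y \<delta>)
       (\<lambda>x y. - lienard_g n m a x \<delta> - y * lienard_f n m b x \<delta> + Y x y \<delta>) (\<lambda>h. P h \<delta>)"
      "poincare_return_map (\<lambda>x y. 0) (\<lambda>x y. - lienard_g n m a x \<delta> - y * lienard_f n m b x \<delta>) (\<lambda>h. Pm h \<delta>)"
      using assms(10,11)[OF \<delta>] .
  qed (use 1 2 assms(1,2) assms(4,5)[OF \<delta>] in auto)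
  moreover have "\<forall>\<^sub>F h in at_right 0.
      (\<lambda>j. (if j = 0 then 0 else v j \<delta> - vbar j \<delta>) * h ^ j) sums (P h \<delta> - Pm h \<delta>)"
    by (rule return_expansion_diff_sums[OF assms(12,13)[OF \<delta>]])
  ultimately have "(if j = 0 then 0 else v j \<delta> - vbar j \<delta>) = 0"
    using j by (intro power_series_coeffs_zero[where N = "k * n + 1"]) auto
  then show "v j \<delta> = vbar j \<delta>" using j by simp
qed

end
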